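(* Let $p$ be a prime and let $A$ be a Henselian valuation ring which is not a field, with field of fractions $K$, maximal ideal $\mathfrak{m}_A$, residue field $k=A/\mathfrak{m}_A$ and additive valuation $v_A$ on $K$. Assume $\operatorname{char}K=\operatorname{char}k=p$. Let $L/K$ be a non-trivial Artin–Schreier extension (so $[L:K]=p$). The following are equivalent: (a) A best $f$ for $L/K$ exists. (b) There exists $f\in K$ generating $L/K$ and satisfying exactly one of the following properties: (i) $f\notin A$ and $v_A(f)$ is not divisible by $p$ (i.e. the class of $f$ in $K^\times/A^\times$ is not a $p$-th power); (ii) $f\notin A$ and $f=ug^{-p}$ for some $0\neq g\in\mathfrak{m}_A$ and $u\in A^\times$ such that the residue class of $u$ is not a $p$-th power in $k$; (iii) $f\in A^\times$ and the residue class $\bar f$ of $f$ does not belong to $\{x^p-x\mid x\in k\}$. (c) The extension $L/K$ is defectless.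
   Context: An element $f\in K$ is said to generate $L/K$ if $L=K(\alpha)$ for a root $\alpha$ of $T^p-T=f$. Any two generators $f,f'$ of $L/K$ satisfy $f'=i(f+h^p-h)$ for some $h\in K$ and some integer $1\le i\le p-1$. A generator $f$ of $L/K$ is called best if $v_A(1/f)=\inf_{h\in K,\,1\le i\le p-1} v_A\big(1/(i(f+h^p-h))\big)$, i.e. $v_A(f)\ge v_A(f')$ for every $f'\in K$ generating $L/K$. Since $A$ is Henselian, $v_A$ extends uniquely to a valuation $v_B$ on $L$ with valuation ring $B$ (the integral closure of $A$ in $L$) and residue field $l$. With $e_{L/K}=[v_B(L^\times):v_A(K^\times)]$ and $f_{L/K}=[l:k]$, the defect $d_{L/K}$ is the positive integer with $[L:K]=d_{L/K}e_{L/K}f_{L/K}$; $L/K$ is defectless if $d_{L/K}=1$. *)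

theory Defs
  imports Main "HOL-Computational_Algebra.Polynomial"
begin

definition valuation_ring :: "'k::field set \<Rightarrow> bool" where
  "valuation_ring A \<longleftrightarrow> 0 \<in> A \<and> 1 \<in> A \<and>
     (\<forall>x\<in>A. \<forall>y\<in>A. x + y \<in> A \<and> x - y \<in> A \<and> x * y \<in> A) \<and>
     (\<forall>x. x \<noteq> 0 \<longrightarrow> x \<in> A \<or> inverse x \<in> A)"

definition units_of_vr :: "'k::field set \<Rightarrow> 'k set" where
  "units_of_vr A = {x. x \<in> A \<and> x \<noteq> 0 \<and> inverse x \<in> A}"

definition max_ideal :: "'k::field set \<Rightarrow> 'k set" where
  "max_ideal A = {x. x \<in> A \<and> (x = 0 \<or> inverse x \<notin> A)}"

definition henselian :: "'k::field set \<Rightarrow> bool" where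
  "henselian A \<longleftrightarrow>
     (\<forall>P :: 'k poly. \<forall>a. (\<forall>i. coeff P i \<in> A) \<and> lead_coeff P = 1 \<and> a \<in> A \<and>
        poly P a \<in> max_ideal A \<and> poly (pderiv P) a \<notin> max_ideal A \<longrightarrow>
        (\<exists>b\<in>A. poly P b = 0 \<and> b - a \<in> max_ideal A))"

text \<open>v_A(x) \<ge> v_A(y), with v_A(0) = \<infinity>.\<close>
definition val_ge :: "'k::field set \<Rightarrow> 'k \<Rightarrow> 'k \<Rightarrow> bool" where
  "val_ge A x y \<longleftrightarrow> (if y = 0 then x = 0 else x / y \<in> A)"

definition field_emb :: "('k::field \<Rightarrow> 'l::field) \<Rightarrow> bool" where
  "field_emb \<iota> \<longleftrightarrow> \<iota> 1 = 1 \<and> (\<forall>x y. \<iota> (x + y) = \<iota> x + \<iota> y \<and> \<iota> (x * y) = \<iota> x * \<iota> y)"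

inductive_set gen_field :: "('k::field \<Rightarrow> 'l::field) \<Rightarrow> 'l \<Rightarrow> 'l set"
  for \<iota> \<alpha> where
  base: "\<iota> c \<in> gen_field \<iota> \<alpha>"
| gen: "\<alpha> \<in> gen_field \<iota> \<alpha>"
| add: "x \<in> gen_field \<iota> \<alpha> \<Longrightarrow> y \<in> gen_field \<iota> \<alpha> \<Longrightarrow> x + y \<in> gen_field \<iota> \<alpha>"
| neg: "x \<in> gen_field \<iota> \<alpha> \<Longrightarrow> - x \<in> gen_field \<iota> \<alpha>"
| mult: "x \<in> gen_field \<iota> \<alpha> \<Longrightarrow> y \<in> gen_field \<iota> \<alpha> \<Longrightarrow> x * y \<in> gen_field \<iota> \<alpha>"
| inv: "x \<in> gen_field \<iota> \<alpha> \<Longrightarrow> inverse x \<in> gen_field \<iota> \<alpha>"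

definition AS_generates :: "nat \<Rightarrow> ('k::field \<Rightarrow> 'l::field) \<Rightarrow> 'k \<Rightarrow> bool" where
  "AS_generates p \<iota> f \<longleftrightarrow> (\<exists>\<alpha>. \<alpha> ^ p - \<alpha> = \<iota> f \<and> gen_field \<iota> \<alpha> = UNIV)"

definition nontrivial_AS_ext :: "nat \<Rightarrow> ('k::field \<Rightarrow> 'l::field) \<Rightarrow> bool" where
  "nontrivial_AS_ext p \<iota> \<longleftrightarrow> (\<exists>f. AS_generates p \<iota> f) \<and> range \<iota> \<noteq> UNIV"

definition best_gen :: "nat \<Rightarrow> ('k::field \<Rightarrow> 'l::field) \<Rightarrow> 'k set \<Rightarrow> 'k \<Rightarrow> bool" where
  "best_gen p \<iota> A f \<longleftrightarrow> AS_generates p \<iota> f \<and> (\<forall>f'. AS_generates p \<iota> f' \<longrightarrow> val_ge A f f')"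

definition int_closure :: "('k::field \<Rightarrow> 'l::field) \<Rightarrow> 'k set \<Rightarrow> 'l set" where
  "int_closure \<iota> A = {x. \<exists>P :: 'k poly. (\<forall>i. coeff P i \<in> A) \<and> lead_coeff P = 1 \<and>
                              poly (map_poly \<iota> P) x = 0}"

definition ext_degree :: "('k::field \<Rightarrow> 'l::field) \<Rightarrow> nat" where
  "ext_degree \<iota> = vector_space.dim (\<lambda>c x. \<iota> c * x) (UNIV :: 'l set)"

text \<open>e_{L/K} = [v_B(L^x) : v_A(K^x)]: the number of classes of L^x modulo
  \<iota>(K^x) \<cdot> B^x, i.e. the index of the image of K^x/A^x in L^x/B^x.\<close>
definition ram_index :: "('k::field \<Rightarrow> 'l::field) \<Rightarrow> 'k set \<Rightarrow> nat" where
  "ram_index \<iota> A = (let B = int_closure \<iota> A in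
     card ({x::'l. x \<noteq> 0} //
       {(x, y). x \<noteq> 0 \<and> y \<noteq> 0 \<and>
          (\<exists>c u. c \<noteq> 0 \<and> u \<in> units_of_vr B \<and> x = \<iota> c * u * y)}))"

text \<open>bs is a list of elements of B whose residues form a basis of l = B/m_B over k = A/m_A.\<close>
definition residue_basis :: "('k::field \<Rightarrow> 'l::field) \<Rightarrow> 'k set \<Rightarrow> 'l list \<Rightarrow> bool" where
  "residue_basis \<iota> A bs \<longleftrightarrow> (let B = int_closure \<iota> A; n = length bs in
     set bs \<subseteq> B \<and>
     (\<forall>as :: 'k list. length as = n \<and> set as \<subseteq> A \<and>
        (\<Sum>i<n. \<iota> (as ! i) * bs ! i) \<in> max_ideal B \<longrightarrow> (\<forall>i<n. as ! i \<in> max_ideal A)) \<and>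
     (\<forall>y\<in>B. \<exists>as :: 'k list. length as = n \<and> set as \<subseteq> A \<and>
        y - (\<Sum>i<n. \<iota> (as ! i) * bs ! i) \<in> max_ideal B))"

definition residue_degree :: "('k::field \<Rightarrow> 'l::field) \<Rightarrow> 'k set \<Rightarrow> nat" where
  "residue_degree \<iota> A = (THE n. \<exists>bs. length bs = n \<and> residue_basis \<iota> A bs)"

definition defectless :: "('k::field \<Rightarrow> 'l::field) \<Rightarrow> 'k set \<Rightarrow> bool" where
  "defectless \<iota> A \<longleftrightarrow> ext_degree \<iota> = ram_index \<iota> A * residue_degree \<iota> A"

end

theory Submission
  imports Defs "HOL-Number_Theory.Cong"
begin

text \<open>
  Let \<open>L = K(\<alpha>)\<close> with \<open>\<alpha> ^ p - \<alpha> = f\<close>.  The generators are the \<open>\<beta> ^ p - \<beta>\<close> with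
  \<open>\<beta> = i * \<alpha> + h\<close>, \<open>0 < i < p\<close>, and Hensel's lemma gives each of them \<open>p\<close> times the valuation of
  \<open>\<beta>\<close>, so a best generator is a best approximation of \<open>\<alpha>\<close> by elements of \<open>K\<close>.

  If \<open>L\<close> contains an element \<open>z\<close> whose value is not in the value group of \<open>K\<close>, or an integral element
  whose residue is not in the residue field of \<open>K\<close>, then for a suitable \<open>z\<close> the powers \<open>1, z, ..., z ^ (p - 1)\<close>
  form a basis in which the valuation of a sum is the minimum of the valuations of its terms.  The
  constant coefficient of \<open>\<alpha>\<close> in such a basis is a best approximation, and one of the ramification
  index and the residue degree is \<open>p\<close>, the other \<open>1\<close>.  If there is no such element, both are \<open>1\<close>.

  A best generator satisfies (i), (ii) or (iii), since otherwise subtracting some \<open>h ^ p - h\<close>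
  increases its valuation; conversely (i) makes \<open>\<alpha>\<close> ramified, and (ii), (iii) make \<open>g * \<alpha>\<close>, \<open>\<alpha>\<close>
  have a new residue.
\<close>

section \<open>Valuation rings\<close>

text \<open>The value group may have any rank and is never formed: values are compared only through
  the preorder \<open>le\<close> and its equivalence \<open>sim\<close>, residues only through
  \<open>lt x 1\<close>. The valuation on \<open>L\<close> starts out as some valuation ring
  \<open>V\<close> over \<open>A\<close>. Hensel's lemma then shows that \<open>V\<close> is stable
  under the automorphism \<sigma> taking \<alpha> to \<alpha> + 1; this identifies \<open>V\<close>
  with the integral closure and gives all conjugates of an element the same value. Norms now tie
  \<open>L\<close> to \<open>K\<close>: the value of \<open>z ^ p\<close> always comes from
  \<open>K\<close>, and so does the residue of \<open>y ^ p\<close> when \<sigma> fixes all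
  residues. Primality of \<open>p\<close> makes the outcome all-or-nothing: an exponent strictly
  between 0 and \<open>p\<close> is invertible modulo \<open>p\<close>, so one new value yields
  \<open>p\<close> classes. For residues the argument splits: if \<sigma> moves a residue, its
  conjugates are \<open>p\<close> distinct residues; if it moves none, a new residue is purely
  inseparable of degree \<open>p\<close>.\<close>

locale subring_set =
  fixes R :: "'a::comm_ring_1 set"
  assumes zero_mem [simp]: "0 \<in> R" and one_mem [simp]: "1 \<in> R"
    and add_mem: "x \<in> R \<Longrightarrow> y \<in> R \<Longrightarrow> x + y \<in> R"
    and diff_mem: "x \<in> R \<Longrightarrow> y \<in> R \<Longrightarrow> x - y \<in> R"
    and mult_mem: "x \<in> R \<Longrightarrow> y \<in> R \<Longrightarrow> x * y \<in> R"
begin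

lemma uminus_mem: "x \<in> R \<Longrightarrow> - x \<in> R"
  using diff_mem[of 0 x] by simp

lemma power_mem: "x \<in> R \<Longrightarrow> x ^ n \<in> R"
  by (induction n) (auto intro: mult_mem)

lemma sum_mem: "(\<And>i. i \<in> I \<Longrightarrow> f i \<in> R) \<Longrightarrow> sum f I \<in> R"
  by (induction I rule: infinite_finite_induct) (auto intro: add_mem)

lemma prod_mem: "(\<And>i. i \<in> I \<Longrightarrow> f i \<in> R) \<Longrightarrow> prod f I \<in> R"
  by (induction I rule: infinite_finite_induct) (auto intro: mult_mem)

lemma of_nat_mem: "of_nat n \<in> R"
  by (induction n) (auto intro: add_mem)

lemma poly_mem: "(\<And>i. coeff P i \<in> R) \<Longrightarrow> x \<in> R \<Longrightarrow> poly P x \<in> R"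
  unfolding poly_altdef by (intro sum_mem mult_mem power_mem)

lemma coeff_mult_mem:
  "(\<And>i. coeff P i \<in> R) \<Longrightarrow> (\<And>i. coeff Q i \<in> R) \<Longrightarrow> coeff (P * Q) n \<in> R"
  unfolding coeff_mult by (intro sum_mem mult_mem)

lemma coeff_prod_mem:
  "(\<And>j i. j \<in> I \<Longrightarrow> coeff (F j) i \<in> R) \<Longrightarrow> coeff (prod F I) k \<in> R"
proof (induction I arbitrary: k rule: infinite_finite_induct)
  case (insert j I)
  then show ?case
    by (simp add: coeff_mult_mem)
qed (auto simp: coeff_pCons split: nat.split)

end

lemma subring_set_adjoin:
  assumes "subring_set R"
  shows "subring_set {poly P u | P. \<forall>i. coeff P i \<in> R}" (is "subring_set ?S")
proof -
  interpret subring_set R by fact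
  show ?thesis
  proof
    show "0 \<in> ?S"
      by (auto intro!: exI[of _ 0])
    show "1 \<in> ?S"
      by (auto intro!: exI[of _ "[:1:]"] simp: coeff_pCons split: nat.split)
  next
    fix x y assume "x \<in> ?S" "y \<in> ?S"
    then obtain P Q where [simp]: "x = poly P u" "y = poly Q u"
      and PQ: "\<And>i. coeff P i \<in> R" "\<And>i. coeff Q i \<in> R" by blast
    show "x + y \<in> ?S"
      using PQ by (auto intro!: exI[of _ "P + Q"] add_mem)
    show "x - y \<in> ?S"
      using PQ by (auto intro!: exI[of _ "P - Q"] diff_mem)
    show "x * y \<in> ?S"
      using PQ by (auto intro!: exI[of _ "P * Q"] coeff_mult_mem)
  qed
qed

locale valring =
  fixes V :: "'a::field set"
  assumes valuation_ring: "valuation_ring V"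
begin

sublocale subring_set V
  using valuation_ring unfolding valuation_ring_def by unfold_locales blast+

text \<open>\<open>le x y\<close> means \<open>v(x) \<ge> v(y)\<close>: the relations compare absolute values, not valuations.\<close>

definition le :: "'a \<Rightarrow> 'a \<Rightarrow> bool" where "le = val_ge V"
definition lt :: "'a \<Rightarrow> 'a \<Rightarrow> bool" where "lt x y \<longleftrightarrow> \<not> le y x"

lemma mem_or_inverse_mem: "x \<noteq> 0 \<Longrightarrow> x \<in> V \<or> inverse x \<in> V"
  using valuation_ring unfolding valuation_ring_def by blast

lemma le_refl [simp]: "le x x"
  by (simp add: le_def val_ge_def)

lemma zero_le [simp]: "le 0 x"
  by (simp add: le_def val_ge_def)

lemma le_zero_iff [simp]: "le x 0 \<longleftrightarrow> x = 0"
  by (simp add: le_def val_ge_def)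

lemma le_one_iff: "le x 1 \<longleftrightarrow> x \<in> V"
  by (simp add: le_def val_ge_def)

lemma le_trans [trans]: "le x y \<Longrightarrow> le y z \<Longrightarrow> le x z"
  using mult_mem[of "x / y" "y / z"] by (auto simp: le_def val_ge_def split: if_splits)

lemma le_total: "le x y \<or> le y x"
  using mem_or_inverse_mem[of "x / y"] by (auto simp: le_def val_ge_def split: if_splits)

lemma le_mult: "le x y \<Longrightarrow> le z w \<Longrightarrow> le (x * z) (y * w)"
  using mult_mem[of "x / y" "z / w"] by (auto simp: le_def val_ge_def split: if_splits)

lemma le_mult_right_iff [simp]: "z \<noteq> 0 \<Longrightarrow> le (x * z) (y * z) \<longleftrightarrow> le x y"
  by (auto simp: le_def val_ge_def)

lemma le_add: "le x z \<Longrightarrow> le y z \<Longrightarrow> le (x + y) z"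
  using add_mem[of "x / z" "y / z"] by (auto simp: le_def val_ge_def add_divide_distrib split: if_splits)

lemma le_uminus_iff [simp]: "le (- x) y \<longleftrightarrow> le x y"
  using uminus_mem[of "x / y"] uminus_mem[of "- x / y"] by (auto simp: le_def val_ge_def)

lemma le_diff: "le x z \<Longrightarrow> le y z \<Longrightarrow> le (x - y) z"
  using le_add[of x z "- y"] by simp

lemma uminus_le_iff [simp]: "le x (- y) \<longleftrightarrow> le x y"
  using uminus_mem[of "x / y"] uminus_mem[of "- (x / y)"] by (auto simp: le_def val_ge_def)

lemma le_sum: "(\<And>i. i \<in> I \<Longrightarrow> le (f i) z) \<Longrightarrow> le (sum f I) z"
  by (induction I rule: infinite_finite_induct) (auto intro: le_add)

lemma lt_imp_le: "lt x y \<Longrightarrow> le x y"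
  using le_total lt_def by blast

lemma lt_le_trans [trans]: "lt x y \<Longrightarrow> le y z \<Longrightarrow> lt x z"
  using le_trans lt_def by blast

lemma le_lt_trans [trans]: "le x y \<Longrightarrow> lt y z \<Longrightarrow> lt x z"
  using le_trans lt_def by blast

lemma lt_irrefl [simp]: "\<not> lt x x"
  by (simp add: lt_def)

lemma not_lt_zero [simp]: "\<not> lt x 0"
  by (simp add: lt_def)

lemma zero_lt_iff [simp]: "lt 0 x \<longleftrightarrow> x \<noteq> 0"
  by (simp add: lt_def)

lemma lt_uminus_iff [simp]: "lt (- x) y \<longleftrightarrow> lt x y" "lt x (- y) \<longleftrightarrow> lt x y"
  by (auto simp: lt_def)

lemma lt_mult_right_iff [simp]: "z \<noteq> 0 \<Longrightarrow> lt (x * z) (y * z) \<longleftrightarrow> lt x y"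
  by (auto simp: lt_def)

lemma lt_mult_le: "lt x y \<Longrightarrow> le z w \<Longrightarrow> w \<noteq> 0 \<Longrightarrow> lt (x * z) (y * w)"
  by (meson le_lt_trans le_mult le_refl lt_mult_right_iff)

lemma le_mult_lt: "le x y \<Longrightarrow> y \<noteq> 0 \<Longrightarrow> lt z w \<Longrightarrow> lt (x * z) (y * w)"
  using lt_mult_le[of z w x y] by (simp add: mult.commute)

lemma lt_add: "lt x z \<Longrightarrow> lt y z \<Longrightarrow> lt (x + y) z"
  by (meson le_add le_lt_trans le_refl le_total)

lemma lt_diff: "lt x z \<Longrightarrow> lt y z \<Longrightarrow> lt (x - y) z"
  using lt_add[of x z "- y"] by simp

lemma lt_sum: "z \<noteq> 0 \<Longrightarrow> (\<And>i. i \<in> I \<Longrightarrow> lt (f i) z) \<Longrightarrow> lt (sum f I) z"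
  by (induction I rule: infinite_finite_induct) (auto intro: lt_add)

text \<open>If \<open>x + y\<close> were strictly smaller than \<open>y\<close>, then so would be
  \<open>y = (x + y) - x\<close>.\<close>

lemma le_add_lt: "lt x y \<Longrightarrow> le y (x + y)"
  using lt_diff[of "x + y" y x] by (metis add_diff_cancel_left' lt_def lt_irrefl)

lemma dominant_sum:
  assumes "finite I" "j \<in> I" "\<And>i. i \<in> I \<Longrightarrow> i \<noteq> j \<Longrightarrow> lt (f i) (f j)" 
  shows "le (f j) (sum f I)"
proof (cases "f j = 0")
  case False
  have "lt (sum f (I - {j})) (f j)"
    using assms False by (intro lt_sum) auto
  then show ?thesis
    using le_add_lt[of "sum f (I - {j})" "f j"] assms by (simp add: sum.remove add.commute)
qed auto

lemma le_power: "le x y \<Longrightarrow> le (x ^ n) (y ^ n)"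
  by (induction n) (auto intro: le_mult)

lemma lt_power: "lt x y \<Longrightarrow> 0 < n \<Longrightarrow> lt (x ^ n) (y ^ n)"
proof (induction n)
  case (Suc n)
  then show ?case
    by (cases "y = 0") (auto intro!: lt_mult_le le_power dest: lt_imp_le)
qed auto

lemma le_power_iff: "0 < n \<Longrightarrow> le (x ^ n) (y ^ n) \<longleftrightarrow> le x y"
  using le_power lt_power lt_def by blast

lemma lt_power_iff: "0 < n \<Longrightarrow> lt (x ^ n) (y ^ n) \<longleftrightarrow> lt x y"
  by (simp add: lt_def le_power_iff)

lemma lt_one_iff: "lt x 1 \<longleftrightarrow> x = 0 \<or> inverse x \<notin> V"
  by (auto simp: lt_def le_def val_ge_def field_simps)

lemma max_ideal_iff: "x \<in> max_ideal V \<longleftrightarrow> lt x 1"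
  using le_one_iff lt_imp_le lt_one_iff unfolding max_ideal_def by blast

lemma units_iff: "x \<in> units_of_vr V \<longleftrightarrow> le x 1 \<and> le 1 x"
  by (auto simp: units_of_vr_def le_def val_ge_def field_simps)

lemma le_iff_exists: "le x y \<longleftrightarrow> (\<exists>c\<in>V. x = c * y)"
  by (cases "y = 0") (auto simp: le_def val_ge_def intro: bexI[of _ "x / y"] exI[of _ 0])

lemma exists_max:
  assumes "finite I" "I \<noteq> {}"
  shows "\<exists>j\<in>I. \<forall>i\<in>I. le (f i) (f j)"
  using assms
proof (induction rule: finite_ne_induct)
  case (insert x F)
  then obtain j where "j \<in> F" "\<forall>i\<in>F. le (f i) (f j)" by blast
  then show ?case
    by (metis insert_iff le_refl le_total le_trans)
qed auto

text \<open>For \<open>x\<close> outside \<open>V\<close> the leading term of \<open>P\<close> at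
  \<open>x\<close> strictly dominates all others, so the sum cannot vanish.\<close>

lemma integral_mem:
  assumes "\<And>i. coeff P i \<in> V" "lead_coeff P = 1" "poly P x = 0"
  shows "x \<in> V"
proof (rule ccontr)
  assume "x \<notin> V"
  then have lt: "lt 1 x"
    by (simp add: lt_def le_one_iff)
  define n where "n = degree P"
  have "lt (coeff P i * x ^ i) (coeff P n * x ^ n)" if "i < n" for i
  proof -
    have "x \<noteq> 0"
      using \<open>x \<notin> V\<close> by auto
    then have "lt (1 * x ^ i) (x ^ (n - i) * x ^ i)"
      using lt_power[OF lt, of "n - i"] that by (subst lt_mult_right_iff) auto
    then show ?thesis
      using le_mult[of "coeff P i" 1 "x ^ i" "x ^ i"] assms that
      by (auto simp: n_def le_one_iff simp flip: power_add intro: le_lt_trans)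
  qed
  then have "le (coeff P n * x ^ n) (\<Sum>i\<le>n. coeff P i * x ^ i)"
    by (intro dominant_sum) auto
  then show False
    using assms \<open>x \<notin> V\<close> by (auto simp: poly_altdef n_def)
qed

lemma one_le_prod: "(\<And>i. i \<in> I \<Longrightarrow> le 1 (f i)) \<Longrightarrow> le 1 (prod f I)"
proof (induction I rule: infinite_finite_induct)
  case (insert j I)
  then show ?case
    using le_mult[of 1 "f j" 1 "prod f I"] by simp
qed auto

lemma one_le_lt_add: "lt x 1 \<Longrightarrow> le 1 y \<Longrightarrow> le 1 (x + y)"
  using le_add_lt[of x y] lt_le_trans le_trans by blast

definition sim :: "'a \<Rightarrow> 'a \<Rightarrow> bool" where "sim x y \<longleftrightarrow> le x y \<and> le y x"

lemma sim_refl [simp]: "sim x x"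
  and sim_sym: "sim x y \<Longrightarrow> sim y x"
  and sim_trans [trans]: "sim x y \<Longrightarrow> sim y z \<Longrightarrow> sim x z"
  and sim_mult: "sim x y \<Longrightarrow> sim z w \<Longrightarrow> sim (x * z) (y * w)"
  and sim_power: "sim x y \<Longrightarrow> sim (x ^ n) (y ^ n)"
  by (auto simp: sim_def intro: le_trans le_mult le_power)

lemma sim_zero_iff [simp]: "sim x 0 \<longleftrightarrow> x = 0" "sim 0 x \<longleftrightarrow> x = 0"
  by (auto simp: sim_def)

lemma sim_divide_iff: "y \<noteq> 0 \<Longrightarrow> sim (x / y) z \<longleftrightarrow> sim x (z * y)"
  using le_mult_right_iff[of y "x / y" z] le_mult_right_iff[of y z "x / y"]
  by (simp add: sim_def)

lemma lt_if_not_sim: "le x y \<Longrightarrow> \<not> sim x y \<Longrightarrow> lt x y"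
  by (simp add: sim_def lt_def)

lemma sim_prod: "(\<And>i. i \<in> I \<Longrightarrow> sim (g i) (h i)) \<Longrightarrow> sim (prod g I) (prod h I)"
  by (induction I rule: infinite_finite_induct) (auto intro: sim_mult)

lemma lt_one_mult: "lt x 1 \<Longrightarrow> y \<in> V \<Longrightarrow> lt (x * y) 1"
  using lt_mult_le[of x 1 y 1] by (simp add: le_one_iff)

lemma lt_one_mult': "x \<in> V \<Longrightarrow> lt y 1 \<Longrightarrow> lt (x * y) 1"
  using lt_one_mult[of y x] by (simp add: mult.commute)

lemma one_le_mult: "le 1 x \<Longrightarrow> le 1 y \<Longrightarrow> le 1 (x * y)"
  using le_mult[of 1 x 1 y] by simp

lemma lt_one_if_mult_lt_one: "lt (x * y) 1 \<Longrightarrow> le 1 y \<Longrightarrow> lt x 1"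
  using one_le_mult[of x y] le_total by (auto simp: lt_def)

section \<open>Polynomials over a valuation ring and their reductions\<close>

lemma poly_lt_one:
  assumes "\<And>i. lt (coeff P i) 1" "x \<in> V"
  shows "lt (poly P x) 1"
  unfolding poly_altdef using assms by (intro lt_sum lt_one_mult power_mem) auto

lemma coeff_synthetic_div_mem:
  assumes "\<And>i. coeff P i \<in> V" "x \<in> V"
  shows "coeff (synthetic_div P x) i \<in> V"
  using assms(1)
proof (induction P arbitrary: i)
  case (pCons a P)
  have P: "coeff P i \<in> V" for i
    using pCons.prems[of "Suc i"] by simp
  then have "coeff (synthetic_div P x) i \<in> V" for i
    by (rule pCons.IH)
  moreover have "poly P x \<in> V"
    using P assms by (intro poly_mem)
  ultimately show ?case
    by (simp add: coeff_pCons split: nat.split)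
qed auto

text \<open>Over the residue field: a polynomial with more distinct roots than its degree is zero.
  Distinct residues appear as differences that are units, and one root at a time is split off by
  synthetic division; the unit \<open>x i - x n\<close> can then be cancelled at the remaining
  roots.\<close>

lemma coeffs_lt_one_if_many_roots:
  assumes "\<And>i. coeff P i \<in> V" "degree P < n" "\<And>i. i < n \<Longrightarrow> x i \<in> V"
    "\<And>i j. i < j \<Longrightarrow> j < n \<Longrightarrow> le 1 (x i - x j)" "\<And>i. i < n \<Longrightarrow> lt (poly P (x i)) 1"
  shows "lt (coeff P k) 1"
  using assms
proof (induction n arbitrary: P k)
  case (Suc n)
  define S where "S = synthetic_div P (x n)"
  have P: "P = [:- x n, 1:] * S + [:poly P (x n):]"
    unfolding S_def by (rule synthetic_div_correct'[symmetric])
  have Pn: "lt (poly P (x n)) 1"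
    using Suc.prems by simp
  have S: "lt (coeff S k) 1" for k
  proof (cases "degree P = 0")
    case True
    then show ?thesis
      unfolding S_def by (metis synthetic_div_eq_0_iff coeff_0 zero_lt_iff zero_neq_one)
  next
    case False
    show ?thesis
    proof (rule Suc.IH)
      show "coeff S i \<in> V" for i
        unfolding S_def using Suc.prems by (intro coeff_synthetic_div_mem) auto
      show "degree S < n"
        using Suc.prems(2) False by (simp add: S_def degree_synthetic_div)
      show "lt (poly S (x i)) 1" if "i < n" for i
      proof (rule lt_one_if_mult_lt_one)
        have "poly P (x i) = (x i - x n) * poly S (x i) + poly P (x n)"
          by (subst P) (simp add: algebra_simps)
        then have "poly S (x i) * (x i - x n) = poly P (x i) - poly P (x n)"
          by (simp add: algebra_simps)
        also have "lt \<dots> 1"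
          using that Suc.prems(5) by (intro lt_diff) auto
        finally show "lt (poly S (x i) * (x i - x n)) 1" .
        show "le 1 (x i - x n)"
          using that Suc.prems by simp
      qed
    qed (use Suc.prems in auto)
  qed
  have "coeff P k = (case k of 0 \<Rightarrow> 0 | Suc k \<Rightarrow> coeff S k) - x n * coeff S k
      + (if k = 0 then poly P (x n) else 0)"
    by (subst P) (simp add: coeff_pCons split: nat.split)
  also have "lt \<dots> 1"
    using S Pn Suc.prems(3) by (intro lt_add lt_diff lt_one_mult') (auto split: nat.split)
  finally show ?case .
qed auto

lemma coeff_pcompose_linear_mem:
  assumes "\<And>i. coeff P i \<in> V" "x \<in> V"
  shows "coeff (pcompose P [:x, 1:]) i \<in> V"
  using assms(1)
proof (induction P arbitrary: i)
  case (pCons a P)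
  have P: "coeff P i \<in> V" for i
    using pCons.prems[of "Suc i"] by simp
  then have "coeff (pcompose P [:x, 1:]) i \<in> V" for i
    by (rule pCons.IH)
  then show ?case
    using assms(2) pCons.prems[of 0] P
    by (auto simp: pcompose_pCons coeff_pCons intro!: add_mem mult_mem poly_mem split: nat.split)
qed auto

lemma coeff_pcompose_linear_lt_one:
  assumes "\<And>i. lt (coeff P i) 1" "x \<in> V"
  shows "lt (coeff (pcompose P [:x, 1:]) i) 1"
  using assms(1)
proof (induction P arbitrary: i)
  case (pCons a P)
  have P: "lt (coeff P i) 1" for i
    using pCons.prems[of "Suc i"] by simp
  then have "lt (coeff (pcompose P [:x, 1:]) i) 1" for i
    by (rule pCons.IH)
  then show ?case
    using assms(2) pCons.prems[of 0] P
    by (auto simp: pcompose_pCons coeff_pCons intro!: lt_add lt_one_mult' poly_lt_one split: nat.split)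
qed auto

lemma prod_cong_power:
  assumes "\<And>i. x i \<in> V" "y \<in> V" "\<And>i. lt (x i - y) 1"
  shows "lt ((\<Prod>i<n. x i) - y ^ n) 1"
proof (induction n)
  case (Suc n)
  have "(\<Prod>i<Suc n. x i) - y ^ Suc n = ((\<Prod>i<n. x i) - y ^ n) * x n + y ^ n * (x n - y)"
    by (simp add: algebra_simps)
  also have "lt \<dots> 1"
    using Suc assms by (intro lt_add lt_one_mult lt_one_mult' power_mem)
  finally show ?case .
qed auto

end

section \<open>Field embeddings and extension of valuation rings\<close>

locale field_embedding =
  fixes \<iota> :: "'k::field \<Rightarrow> 'l::field"
  assumes emb: "field_emb \<iota>"
begin

lemma emb_one [simp]: "\<iota> 1 = 1"
  and emb_add: "\<iota> (x + y) = \<iota> x + \<iota> y"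
  and emb_mult: "\<iota> (x * y) = \<iota> x * \<iota> y"
  using emb unfolding field_emb_def by blast+

lemma emb_zero [simp]: "\<iota> 0 = 0"
  using emb_add[of 0 0] by (metis add.right_neutral add_left_cancel)

lemma emb_uminus: "\<iota> (- x) = - \<iota> x"
  using emb_add[of x "- x"] by (simp add: eq_neg_iff_add_eq_0 add.commute)

lemma emb_diff: "\<iota> (x - y) = \<iota> x - \<iota> y"
  using emb_add[of x "- y"] by (simp add: emb_uminus)

lemma emb_eq_zero_iff [simp]: "\<iota> x = 0 \<longleftrightarrow> x = 0"
  using emb_mult[of x "inverse x"] by (cases "x = 0") auto

lemma emb_eq_iff [simp]: "\<iota> x = \<iota> y \<longleftrightarrow> x = y"
  using emb_eq_zero_iff[of "x - y"] by (simp add: emb_diff)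

lemma emb_inverse: "\<iota> (inverse x) = inverse (\<iota> x)"
  by (cases "x = 0") (auto simp flip: emb_mult intro!: inverse_unique[symmetric])

lemma emb_divide: "\<iota> (x / y) = \<iota> x / \<iota> y"
  by (simp add: divide_inverse emb_mult emb_inverse)

lemma emb_power: "\<iota> (x ^ n) = \<iota> x ^ n"
  by (induction n) (auto simp: emb_mult)

lemma emb_sum: "\<iota> (sum f I) = (\<Sum>i\<in>I. \<iota> (f i))"
  by (induction I rule: infinite_finite_induct) (auto simp: emb_add)

lemma emb_of_nat: "\<iota> (of_nat n) = of_nat n"
  by (induction n) (auto simp: emb_add)

lemma prod_emb: "\<iota> (prod f I) = (\<Prod>i\<in>I. \<iota> (f i))"
  by (induction I rule: infinite_finite_induct) (auto simp: emb_mult)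

lemmas emb_simps = emb_add emb_mult emb_uminus emb_diff emb_inverse emb_divide emb_power
  emb_sum emb_of_nat

abbreviation lift :: "'k poly \<Rightarrow> 'l poly" where "lift \<equiv> map_poly \<iota>"

lemma coeff_lift [simp]: "coeff (lift P) i = \<iota> (coeff P i)"
  by (simp add: coeff_map_poly)

lemma degree_lift [simp]: "degree (lift P) = degree P"
  by (intro degree_map_poly) auto

lemma lift_eq_zero_iff [simp]: "lift P = 0 \<longleftrightarrow> P = 0"
  by (auto simp: poly_eq_iff)

lemma lift_add: "lift (P + Q) = lift P + lift Q"
  and lift_diff: "lift (P - Q) = lift P - lift Q"
  and lift_uminus: "lift (- P) = - lift P"
  and lift_mult: "lift (P * Q) = lift P * lift Q"
  and lift_smult: "lift (smult c P) = smult (\<iota> c) (lift P)"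
  and lift_pCons: "lift (pCons c P) = pCons (\<iota> c) (lift P)"
  by (auto intro!: poly_eqI simp: emb_simps coeff_mult coeff_pCons split: nat.split)

lemma lift_prod: "lift (prod f I) = (\<Prod>i\<in>I. lift (f i))"
  by (induction I rule: infinite_finite_induct) (auto simp: lift_mult)

lemma lift_power: "lift (P ^ n) = lift P ^ n"
  by (induction n) (auto simp: lift_mult)

lemma lift_pcompose: "lift (pcompose P Q) = pcompose (lift P) (lift Q)"
  by (induction P) (auto simp: pcompose_pCons lift_add lift_mult lift_pCons)

lemma lift_pderiv: "lift (pderiv P) = pderiv (lift P)"
  by (auto intro!: poly_eqI simp: coeff_pderiv emb_simps)

lemma lift_monom: "lift (monom c n) = monom (\<iota> c) n"
  by (simp add: map_poly_monom)

lemma poly_lift_emb [simp]: "poly (lift P) (\<iota> x) = \<iota> (poly P x)"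
  by (induction P) (auto simp: lift_pCons emb_simps)

lemmas lift_simps = lift_add lift_diff lift_uminus lift_mult lift_smult lift_pCons lift_prod
  lift_power lift_pcompose lift_pderiv lift_monom

lemma gen_field_notin_range:
  assumes "gen_field \<iota> \<beta> = UNIV" "range \<iota> \<noteq> UNIV"
  shows "\<beta> \<notin> range \<iota>"
proof
  assume \<beta>: "\<beta> \<in> range \<iota>"
  have "x \<in> range \<iota>" if "x \<in> gen_field \<iota> \<beta>" for x
    using that
  proof induction
    case (inv x)
    then show ?case by (auto simp flip: emb_inverse)
  next
    case (neg x)
    then show ?case by (auto simp flip: emb_uminus)
  qed (use \<beta> in \<open>auto simp flip: emb_add emb_mult\<close>)
  then show False
    using assms by auto
qed

text \<open>The condition \<open>\<iota> -` R = A\<close> says that \<open>1\<close> is not in the ideal of \<open>R\<close> generated by the maximal ideal of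
  \<open>A\<close>; a subring maximal for it is a valuation ring.\<close>

lemma exists_valuation_ring_extension:
  assumes "valuation_ring A"
  shows "\<exists>V. valuation_ring V \<and> \<iota> -` V = A"
proof -
  interpret A: valring A by unfold_locales fact
  define F where "F = {R. subring_set R \<and> \<iota> -` R = A}"
  have "\<exists>M\<in>F. \<forall>X\<in>F. M \<subseteq> X \<longrightarrow> X = M"
  proof (rule subset_Zorn_nonempty)
    have "subring_set (\<iota> ` A)"
      by unfold_locales
        (auto intro: image_eqI[of _ _ 0] image_eqI[of _ _ 1] A.add_mem A.diff_mem A.mult_mem
          simp flip: emb_add emb_diff emb_mult)
    moreover have "\<iota> -` \<iota> ` A = A"
      by auto
    ultimately show "F \<noteq> {}"
      by (auto simp: F_def)
  next
    fix C assume C: "C \<noteq> {}" "subset.chain F C"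
    have sub: "subring_set X" if "X \<in> C" for X
      using that C by (auto simp: F_def subset_chain_def)
    have two: "\<exists>Z\<in>C. x \<in> Z \<and> y \<in> Z" if xy: "x \<in> \<Union>C" "y \<in> \<Union>C" for x y
    proof -
      obtain X Y where XY: "X \<in> C" "x \<in> X" "Y \<in> C" "y \<in> Y"
        using xy by blast
      then have "X \<subseteq> Y \<or> Y \<subseteq> X"
        using C(2) by (auto simp: subset_chain_def)
      then show ?thesis
        using XY by blast
    qed
    have "subring_set (\<Union>C)"
    proof
      obtain X where "X \<in> C"
        using C by blast
      then show "0 \<in> \<Union>C" "1 \<in> \<Union>C"
        using subring_set.zero_mem[OF sub] subring_set.one_mem[OF sub] by blast+
    next
      fix x y assume "x \<in> \<Union>C" "y \<in> \<Union>C"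
      then obtain Z where Z: "Z \<in> C" "x \<in> Z" "y \<in> Z"
        using two by blast
      interpret Z: subring_set Z
        by (rule sub) fact
      show "x + y \<in> \<Union>C" "x - y \<in> \<Union>C" "x * y \<in> \<Union>C"
        using Z Z.add_mem Z.diff_mem Z.mult_mem by blast+
    qed
    moreover have "\<iota> -` (\<Union>C) = A"
      using C by (auto simp: F_def subset_chain_def)
    ultimately show "\<Union>C \<in> F"
      by (simp add: F_def)
  qed
  then obtain M where "M \<in> F" and max: "\<forall>X\<in>F. M \<subseteq> X \<longrightarrow> X = M"
    by (rule bexE)
  then have M: "subring_set M" "\<iota> -` M = A"
    by (simp_all add: F_def)
  have mem_A: "\<iota> c \<in> M \<longleftrightarrow> c \<in> A" for c
    using M(2) by (metis vimage_eq)
  have maximal: "X = M" if "subring_set X" "\<iota> -` X = A" "M \<subseteq> X" for X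
    using max that by (simp add: F_def)
  interpret subring_set M by fact
  \<comment> \<open>This is the ideal of \<open>M\<close> generated by the maximal ideal of
    \<open>A\<close>. Single products suffice: of two elements of \<open>A\<close> one divides the
    other, so a sum of two products is again one product.\<close>
  define I where "I = {\<iota> a * r | a r. a \<in> max_ideal A \<and> r \<in> M}"
  have I_M: "x \<in> M" if "x \<in> I" for x
    using that mem_A by (auto simp: I_def max_ideal_def intro!: mult_mem)
  have I_mult: "x * y \<in> I" if "x \<in> I" "y \<in> M" for x y
    using that unfolding I_def by (smt (verit) mem_Collect_eq mult.assoc mult_mem)
  have I_zero [simp]: "0 \<in> I"
    unfolding I_def by (simp, intro exI[of _ 0]) (simp add: A.max_ideal_iff)
  have I_add': "\<iota> a * r + \<iota> b * s \<in> I"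
    if ab: "A.le a b" "b \<in> max_ideal A" "r \<in> M" "s \<in> M" for a b r s
  proof -
    obtain c where c: "c \<in> A" "a = c * b"
      using ab by (auto simp: A.le_iff_exists)
    then have "\<iota> c * r + s \<in> M"
      using that mem_A by (intro add_mem mult_mem) simp_all
    moreover have "\<iota> a * r + \<iota> b * s = \<iota> b * (\<iota> c * r + s)"
      using c by (simp add: emb_simps algebra_simps)
    ultimately show ?thesis
      using that(2) by (auto simp: I_def)
  qed
  have I_add: "x + y \<in> I" if xy: "x \<in> I" "y \<in> I" for x y
  proof -
    obtain a r b s where *: "x = \<iota> a * r" "a \<in> max_ideal A" "r \<in> M"
      "y = \<iota> b * s" "b \<in> max_ideal A" "s \<in> M"
      using xy unfolding I_def by blast
    show ?thesis
      using A.le_total[of a b] I_add'[of a b r s] I_add'[of b a s r] *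
      by (auto simp: add.commute)
  qed
  have I_sum: "sum f J \<in> I" if "\<And>i. i \<in> J \<Longrightarrow> f i \<in> I" for f and J :: "nat set"
    using that by (induction J rule: infinite_finite_induct) (auto intro: I_add)
  have one_notin_I: "1 \<notin> I"
  proof
    assume "1 \<in> I"
    then obtain a r where a: "a \<in> max_ideal A" "r \<in> M" "1 = \<iota> a * r"
      unfolding I_def by blast
    then have "a \<noteq> 0" by auto
    then have "r = \<iota> (inverse a)"
      using a by (simp add: emb_simps field_simps)
    then have "inverse a \<in> A"
      using a mem_A by simp
    with a \<open>a \<noteq> 0\<close> show False
      by (auto simp: max_ideal_def)
  qed
  \<comment> \<open>By maximality, adjoining \<open>u\<close> puts some \<open>c\<close> outside
    \<open>A\<close> into the ring. Then \<open>inverse c\<close> lies in the maximal ideal, and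
    dividing the polynomial expression of \<open>c\<close> by \<open>c\<close> writes 1 with
    coefficients in \<open>I\<close>.\<close>
  have rel: "\<exists>q. (\<forall>i. coeff q i \<in> I) \<and> poly q u = 1" if u: "u \<notin> M" for u
  proof -
    define X where "X = {poly P u | P. \<forall>i. coeff P i \<in> M}"
    have MX: "M \<subseteq> X"
    proof
      fix x assume "x \<in> M"
      then show "x \<in> X"
        unfolding X_def by (auto intro!: exI[of _ "[:x:]"] simp: coeff_pCons split: nat.split)
    qed
    moreover have "u \<in> X"
      unfolding X_def by (auto intro!: exI[of _ "[:0, 1:]"] simp: coeff_pCons split: nat.split)
    ultimately have "\<iota> -` X \<noteq> A"
      using maximal[of X] u subring_set_adjoin[OF M(1), of u] unfolding X_def by blast
    then obtain c where c: "\<iota> c \<in> X" "c \<notin> A"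
      using mem_A MX by (metis subsetD subsetI subset_antisym vimage_eq)
    then obtain P where P: "\<iota> c = poly P u" "\<And>i. coeff P i \<in> M"
      unfolding X_def by blast
    have "c \<noteq> 0"
      using c by auto
    then have "inverse c \<in> max_ideal A"
      using c(2) A.mem_or_inverse_mem[of c] by (simp add: max_ideal_def)
    then have "\<forall>i. coeff (smult (\<iota> (inverse c)) P) i \<in> I"
      using P unfolding I_def by auto
    moreover have "poly (smult (\<iota> (inverse c)) P) u = 1"
      using \<open>c \<noteq> 0\<close> by (simp flip: P emb_mult)
    ultimately show ?thesis by blast
  qed
  \<comment> \<open>Elements of \<open>1 + I\<close> are units of \<open>M\<close>: clearing
    denominators in a relation for \<open>inverse (1 - b)\<close> would put a power of
    \<open>1 - b\<close> into \<open>I\<close>, although every such power is congruent to 1 modulo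
    \<open>I\<close>.\<close>
  have inv: "inverse (1 - b) \<in> M" if b: "b \<in> I" for b
  proof (rule ccontr)
    assume "inverse (1 - b) \<notin> M"
    then obtain q where q: "\<And>i. coeff q i \<in> I" "poly q (inverse (1 - b)) = 1"
      using rel by blast
    have "b \<noteq> 1"
      using b one_notin_I by blast
    define n where "n = degree q"
    have "(1 - b) ^ n = (\<Sum>i\<le>n. coeff q i * inverse (1 - b) ^ i) * (1 - b) ^ n"
      using q by (simp add: poly_altdef n_def)
    also have "\<dots> = (\<Sum>i\<le>n. coeff q i * (1 - b) ^ (n - i))"
      unfolding sum_distrib_right using \<open>b \<noteq> 1\<close>
      by (intro sum.cong) (auto simp: power_diff field_simps)
    also have "\<dots> \<in> I"
      using q b by (intro I_sum I_mult power_mem diff_mem) (auto intro: I_M)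
    finally have "(1 - b) ^ n \<in> I" .
    moreover have "1 - (1 - b) ^ m \<in> I" for m
    proof (induction m)
      case (Suc m)
      have *: "1 - (1 - b) ^ Suc m = (1 - (1 - b) ^ m) + b * (1 - b) ^ m"
        by (simp add: algebra_simps)
      show ?case
        unfolding * using Suc b by (intro I_add I_mult power_mem diff_mem) (auto intro: I_M)
    qed auto
    ultimately have "(1 - b) ^ n + (1 - (1 - b) ^ n) \<in> I"
      by (intro I_add)
    then show False
      using one_notin_I by simp
  qed
  \<comment> \<open>Descent on the degree: as \<open>1 - coeff r 0\<close> is a unit, the relation
    in \<open>inverse u\<close>, multiplied by a power of \<open>u\<close>, expresses the leading
    power of \<open>u\<close> in \<open>q\<close> by lower ones.\<close>
  have reduce: "\<exists>q'. (\<forall>i. coeff q' i \<in> I) \<and> poly q' u = 1 \<and> degree q' < degree q"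
    if "u \<noteq> 0" "\<And>i. coeff q i \<in> I" "\<And>i. coeff r i \<in> I" "poly q u = 1" "poly r (inverse u) = 1"
      "degree r \<le> degree q" for q r u
  proof -
    define n m w where "n = degree q" and "m = degree r" and "w = inverse (1 - coeff r 0)"
    have "n \<noteq> 0"
    proof
      assume "n = 0"
      then obtain a where "q = [:a:]"
        using degree_eq_zeroE[of q] n_def by metis
      then show False
        using that(2)[of 0] that(4) one_notin_I by simp
    qed
    have "1 - coeff r 0 \<noteq> 0"
      using that(3)[of 0] one_notin_I by auto
    then have w: "w \<in> M" "w * (1 - coeff r 0) = 1"
      using inv[OF that(3)[of 0]] by (auto simp: w_def)
    \<comment> \<open>The relation for \<open>inverse u\<close> gives \<open>1 = w * (sum of coeff r
      j * inverse u ^ j over 1 \<le> j \<le> m)\<close>; multiplied by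
      \<open>coeff q n * u ^ n\<close> this is a substitute for the leading term of
      \<open>q\<close>.\<close>
    define s where "s = (\<Sum>j=1..m. monom (coeff r j * (w * coeff q n)) (n - j))"
    define q' where "q' = (q - monom (coeff q n) n) + s"
    have "degree (q - monom (coeff q n) n) < n"
      using \<open>n \<noteq> 0\<close> by (intro degree_lessI) (auto simp: n_def coeff_eq_0)
    moreover have "degree s < n"
      unfolding s_def using \<open>n \<noteq> 0\<close> 
      by (intro degree_sum_less le_less_trans[OF degree_monom_le]) auto
    ultimately have "degree q' < n"
      unfolding q'_def by (rule degree_add_less)
    moreover have "coeff q' i \<in> I" for i
    proof -
      have "coeff (q - monom (coeff q n) n) i \<in> I"
        using that(2) by auto
      moreover have "coeff s i \<in> I"
        unfolding s_def coeff_sum using I_mult[OF that(3) mult_mem[OF w(1) I_M[OF that(2)]]]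
        by (intro I_sum) auto
      ultimately show ?thesis
        by (auto simp: q'_def intro: I_add)
    qed
    moreover have "poly q' u = 1"
    proof -
      have "1 = (\<Sum>j\<le>m. coeff r j * inverse u ^ j)"
        using that(5) by (simp add: poly_altdef m_def)
      also have "{..m} = insert 0 {1..m}"
        by auto
      finally have "1 - coeff r 0 = (\<Sum>j=1..m. coeff r j * inverse u ^ j)"
        by (simp add: algebra_simps)
      then have "(1 - coeff r 0) * (w * coeff q n * u ^ n)
          = (\<Sum>j=1..m. (coeff r j * inverse u ^ j) * (w * coeff q n * u ^ n))"
        by (simp add: sum_distrib_right)
      also have "\<dots> = poly s u"
        unfolding s_def poly_sum poly_monom using that(1,6)
        by (intro sum.cong) (auto simp: power_diff field_simps n_def m_def)
      finally have "poly s u = (w * (1 - coeff r 0)) * (coeff q n * u ^ n)"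
        by (simp only: ac_simps)
      then have "poly s u = coeff q n * u ^ n"
        using w(2) by simp
      then show ?thesis
        using that(4) by (simp add: q'_def poly_monom)
    qed
    ultimately show ?thesis
      unfolding n_def by blast
  qed
  \<comment> \<open>The sum of the two degrees decreases; when \<open>r\<close> has the larger
    degree, \<open>u\<close> and \<open>inverse u\<close> exchange roles.\<close>
  have contradiction: False
    if "u \<noteq> 0" "\<And>i. coeff q i \<in> I" "\<And>i. coeff r i \<in> I" "poly q u = 1" "poly r (inverse u) = 1"
    for q r u
    using that
  proof (induction "degree q + degree r" arbitrary: q r u rule: less_induct)
    case less
    show ?case
    proof (cases "degree r \<le> degree q")
      case True
      then obtain q' where "\<forall>i. coeff q' i \<in> I" "poly q' u = 1" "degree q' < degree q"
        using reduce[OF less.prems] by blast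
      then show ?thesis
        using less.hyps[of q' r u] less.prems by auto
    next
      case False
      then obtain r' where "\<forall>i. coeff r' i \<in> I" "poly r' (inverse u) = 1" "degree r' < degree r"
        using reduce[of "inverse u" r q] less.prems by auto
      then show ?thesis
        using less.hyps[of q r' u] less.prems by auto
    qed
  qed
  have "valuation_ring M"
    unfolding valuation_ring_def using rel contradiction
    by (auto intro: add_mem diff_mem mult_mem) blast
  then show ?thesis
    using M by blast
qed

end

section \<open>Artin--Schreier extensions\<close>

text \<open>Applied to products over the cyclic group generated by \<sigma>, where shifting the
  index only permutes the conjugates.\<close>

lemma prod_Suc_mod_shift:
  fixes g :: "nat \<Rightarrow> 'a::comm_monoid_mult"
  assumes "g n = g 0"
  shows "(\<Prod>i<n. g (Suc i)) = (\<Prod>i<n. g i)"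
proof (cases n)
  case (Suc m)
  then have "(\<Prod>i<n. g (Suc i)) = g 0 * (\<Prod>i<m. g (Suc i))"
    using assms by (simp add: mult.commute)
  also have "\<dots> = (\<Prod>i<n. g i)"
    unfolding Suc by (rule prod.lessThan_Suc_shift[symmetric])
  finally show ?thesis .
qed auto

lemma eq_const_if_many_roots:
  fixes P :: "'a::idom poly"
  assumes "inj_on g {..<n}" "degree P < n" "\<And>i. i < n \<Longrightarrow> poly P (g i) = c"
  shows "P = [:c:]"
proof (rule ccontr)
  assume "P \<noteq> [:c:]"
  then have nz: "P - [:c:] \<noteq> 0"
    by simp
  have "n = card (g ` {..<n})"
    using assms by (simp add: card_image)
  also have "\<dots> \<le> card {x. poly (P - [:c:]) x = 0}"
    using assms by (intro card_mono poly_roots_finite nz) auto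
  also have "\<dots> \<le> degree (P - [:c:])"
    using nz by (rule card_poly_roots_bound)
  also have "\<dots> \<le> degree P"
    by (intro degree_diff_le) auto
  finally show False
    using assms by simp
qed

text \<open>The Artin--Schreier map, additive in characteristic \<open>p\<close> with the prime
  field as kernel.\<close>

definition wp :: "nat \<Rightarrow> 'a::comm_ring_1 \<Rightarrow> 'a" where
  "wp p x = x ^ p - x"

locale char_p =
  fixes p :: nat and T :: "'a::field itself"
  assumes prime: "prime p" and char: "CHAR('a) = p"
begin

lemma p_pos: "0 < p" and p_gt_1: "1 < p"
  using prime prime_gt_0_nat prime_gt_1_nat by blast+

lemma of_nat_eq_0_iff: "of_nat n = (0::'a) \<longleftrightarrow> p dvd n"
  by (simp add: of_nat_eq_0_iff_char_dvd char)

lemma of_nat_p [simp]: "of_nat p = (0::'a)"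
  by (simp add: of_nat_eq_0_iff)

lemma inj_on_of_nat: "inj_on (of_nat :: nat \<Rightarrow> 'a) {..<p}"
proof -
  have "of_nat i \<noteq> (of_nat j :: 'a)" if "i < j" "j < p" for i j
  proof
    assume "of_nat i = (of_nat j :: 'a)"
    then have "of_nat (j - i) = (0::'a)"
      using that(1) by (simp add: of_nat_diff)
    then have "p dvd j - i"
      by (simp only: of_nat_eq_0_iff)
    then show False
      using that by (auto dest: dvd_imp_le)
  qed
  then show ?thesis
    by (intro linorder_inj_onI) auto
qed

lemma frobenius_add: "(x + y) ^ p = x ^ p + (y::'a) ^ p"
  using freshmans_dream[where ?'a = 'a] prime char by metis

lemma frobenius_minus: "(- x) ^ p = - ((x::'a) ^ p)"
  using frobenius_add[of x "- x"] p_pos by (simp add: eq_neg_iff_add_eq_0 add.commute power_0_left)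

lemma frobenius_diff: "(x - y) ^ p = x ^ p - (y::'a) ^ p"
  using frobenius_add[of x "- y"] by (simp add: frobenius_minus)

lemma wp_add: "wp p (x + y) = wp p x + wp p (y::'a)"
  by (simp add: wp_def frobenius_add)

lemma wp_diff: "wp p (x - y) = wp p x - wp p (y::'a)"
  by (simp add: wp_def frobenius_diff)

lemma of_nat_power_p: "of_nat i ^ p = (of_nat i :: 'a)"
  by (induction i) (auto simp: frobenius_add p_pos)

lemma wp_of_nat [simp]: "wp p (of_nat i :: 'a) = 0"
  by (simp add: wp_def of_nat_power_p)

lemma wp_eq_0_iff: "wp p (x::'a) = 0 \<longleftrightarrow> (\<exists>i<p. x = of_nat i)"
proof
  assume x: "wp p x = 0"
  define P where "P = monom (1::'a) p - monom 1 1"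
  have deg: "degree P = p"
    unfolding P_def using p_gt_1 by (intro antisym degree_le le_degree) auto
  show "\<exists>i<p. x = of_nat i"
  proof (rule ccontr)
    assume nex: "\<not> (\<exists>i<p. x = of_nat i)"
    \<comment> \<open>The elements of the prime field together with \<open>x\<close> would be
      \<open>p + 1\<close> distinct roots of a polynomial of degree \<open>p\<close>.\<close>
    define g where "g i = (if i < p then of_nat i else x)" for i
    have "inj_on g {..<Suc p}"
      using inj_on_of_nat nex unfolding g_def inj_on_def by (auto simp: less_Suc_eq)
    moreover have "poly P (g i) = 0" for i
      using x of_nat_power_p by (simp add: g_def P_def poly_monom wp_def)
    ultimately have "P = [:0:]"
      using deg by (intro eq_const_if_many_roots[of g "Suc p"]) auto
    then show False
      using deg p_pos by simp
  qed
qed auto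

end

locale AS_ext = field_embedding \<iota> + K: char_p p "TYPE('k)"
  for \<iota> :: "'k::field \<Rightarrow> 'l::field" and p :: nat +
  fixes \<alpha> :: 'l and f :: 'k
  assumes root: "wp p \<alpha> = \<iota> f" and gen: "gen_field \<iota> \<alpha> = UNIV" and nontrivial: "range \<iota> \<noteq> UNIV"
begin

sublocale L: char_p p "TYPE('l)"
proof
  show "prime p"
    by (rule K.prime)
  show "CHAR('l) = p"
  proof (rule CHAR_eqI)
    show "of_nat p = (0::'l)"
      using emb_of_nat[of p] by simp
    show "p dvd n" if "of_nat n = (0::'l)" for n
      using that emb_of_nat[of n] K.of_nat_eq_0_iff by (metis emb_eq_zero_iff)
  qed
qed

lemma emb_wp: "\<iota> (wp p x) = wp p (\<iota> x)"
  by (simp add: wp_def emb_simps)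

lemma gen_notin_range: "\<alpha> \<notin> range \<iota>"
  using gen nontrivial by (rule gen_field_notin_range)

section \<open>The Artin--Schreier polynomial as minimal polynomial of \<alpha>\<close>

definition AS_poly :: "'k poly" where
  "AS_poly = monom 1 p - monom 1 1 - [:f:]"

lemma degree_AS_poly: "degree AS_poly = p"
  unfolding AS_poly_def using K.p_gt_1
  by (intro antisym degree_le le_degree) (auto simp: coeff_pCons split: nat.split)

lemma AS_poly_root: "poly (lift AS_poly) (\<alpha> + of_nat i) = 0"
proof -
  have "poly (lift AS_poly) (\<alpha> + of_nat i) = wp p (\<alpha> + of_nat i) - \<iota> f"
    by (simp add: AS_poly_def lift_simps poly_monom wp_def)
  then show ?thesis
    by (simp add: L.wp_add root)
qed

lemma inj_shift: "inj_on (\<lambda>j. of_nat j * of_nat i + (x::'k)) {..<p}" if "0 < i" "i < p"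
proof -
  have "of_nat i \<noteq> (0::'k)"
    using that by (auto simp: K.of_nat_eq_0_iff dest: dvd_imp_le)
  then show ?thesis
    using K.inj_on_of_nat by (auto simp: inj_on_def)
qed

text \<open>The multiples of \<open>i\<close> are \<open>p\<close> distinct arguments at which the
  polynomial takes the same value, more than its degree allows unless it is constant.\<close>

lemma shift_invariant_imp_const:
  assumes "pcompose P [:of_nat i, 1:] = P" "0 < i" "i < p" "degree P < p"
  shows "P = [:poly P (0::'k):]"
proof (rule eq_const_if_many_roots)
  show "inj_on (\<lambda>j. of_nat j * of_nat i + (0::'k)) {..<p}"
    using inj_shift assms by blast
  show "poly P (of_nat j * of_nat i + 0) = poly P 0" for j
  proof (induction j)
    case (Suc j)
    have "poly P (of_nat (Suc j) * of_nat i + 0) = poly (pcompose P [:of_nat i, 1:]) (of_nat j * of_nat i)"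
      by (simp add: poly_pcompose algebra_simps)
    then show ?case
      using Suc assms by simp
  qed auto
qed (use assms in auto)

lemma degree_shift [simp]: "degree (pcompose P [:c, 1:]) = degree (P :: 'k poly)"
  by (simp add: degree_pcompose)

lemma degree_shift_diff_less:
  assumes "0 < degree (P :: 'k poly)"
  shows "degree (pcompose P [:c, 1:] - P) < degree P"
proof (rule degree_lessI)
  show "pcompose P [:c, 1:] - P \<noteq> 0 \<or> 0 < degree P"
    using assms by simp
  show "\<forall>k\<ge>degree P. coeff (pcompose P [:c, 1:] - P) k = 0"
  proof safe
    fix k assume "degree P \<le> k"
    show "coeff (pcompose P [:c, 1:] - P) k = 0"
    proof (cases "k = degree P")
      case True
      then show ?thesis
        using lead_coeff_comp[of "[:c, 1:]" P] by simp
    next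
      case False
      then show ?thesis
        using \<open>degree P \<le> k\<close> by (simp add: coeff_eq_0)
    qed
  qed
qed

text \<open>A nonzero polynomial \<open>M\<close> of minimal degree \<open>n < p\<close> killing \<open>\<alpha>\<close> divides the Artin--Schreier
  polynomial.  As \<open>M(T + i) - M(T)\<close> has smaller degree, the roots \<open>\<alpha> + i\<close> with \<open>0 < i < p\<close> belong
  to the cofactor, whose degree \<open>p - n\<close> is therefore at least \<open>p - 1\<close>.\<close>

lemma poly_gen_nonzero:
  assumes "Q \<noteq> 0" "degree Q < p"
  shows "poly (lift Q) \<alpha> \<noteq> 0"
proof
  assume "poly (lift Q) \<alpha> = 0"
  define good where "good n \<longleftrightarrow> (\<exists>M. M \<noteq> 0 \<and> poly (lift M) \<alpha> = 0 \<and> degree M = n)" for n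
  define n where "n = (LEAST n. good n)"
  have "good (degree Q)"
    using assms \<open>poly (lift Q) \<alpha> = 0\<close> by (auto simp: good_def)
  then have "good n" "n \<le> degree Q"
    unfolding n_def by (auto intro: LeastI Least_le)
  then obtain M where M: "M \<noteq> 0" "poly (lift M) \<alpha> = 0" "degree M = n"
    unfolding good_def by blast
  have minimal: "P = 0" if "poly (lift P) \<alpha> = 0" "degree P < n" for P
    using that not_less_Least[of "degree P" good] unfolding n_def good_def by blast
  have "n > 0"
  proof (rule ccontr)
    assume "\<not> n > 0"
    then obtain c where "M = [:c:]"
      using M degree_eq_zeroE by blast
    then show False
      using M by (auto simp: lift_simps)
  qed
  have "n < p"
    using \<open>n \<le> degree Q\<close> assms by simp
  define S where "S = AS_poly div M"
  have "AS_poly mod M = 0"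
  proof (rule minimal)
    have "poly (lift AS_poly) \<alpha> = poly (lift (AS_poly div M * M + AS_poly mod M)) \<alpha>"
      by simp
    then show "poly (lift (AS_poly mod M)) \<alpha> = 0"
      using AS_poly_root[of 0] M by (simp only: lift_simps) simp
    show "degree (AS_poly mod M) < n"
      using degree_mod_less'[of M AS_poly] M \<open>n > 0\<close> by (cases "AS_poly mod M = 0") auto
  qed
  then have S: "AS_poly = S * M"
    by (auto simp: S_def)
  have "S \<noteq> 0"
    using S degree_AS_poly K.p_pos by auto
  then have "p = degree S + n"
    using S M degree_AS_poly degree_mult_eq[of S M] by simp
  have S_root: "poly (lift S) (\<alpha> + of_nat i) = 0" if i: "0 < i" "i < p" for i
  proof -
    have "poly (lift M) (\<alpha> + of_nat i) \<noteq> 0"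
    proof
      assume "poly (lift M) (\<alpha> + of_nat i) = 0"
      then have "poly (lift (pcompose M [:of_nat i, 1:] - M)) \<alpha> = 0"
        using M by (simp add: lift_simps poly_pcompose emb_of_nat add.commute)
      then have "pcompose M [:of_nat i, 1:] - M = 0"
        using minimal degree_shift_diff_less[of M] M \<open>n > 0\<close> by blast
      then have "M = [:poly M 0:]"
        using i M \<open>n < p\<close> by (intro shift_invariant_imp_const[of _ i]) auto
      then have "degree M = 0"
        by (metis degree_pCons_0)
      then show False
        using M \<open>n > 0\<close> by simp
    qed
    then show ?thesis
      using AS_poly_root[of i] by (simp add: S lift_simps)
  qed
  have "card ((\<lambda>i. \<alpha> + of_nat i) ` {1..<p}) \<le> card {x. poly (lift S) x = 0}"
    using \<open>S \<noteq> 0\<close> S_root by (intro card_mono poly_roots_finite) auto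
  also have "\<dots> \<le> degree S"
    using \<open>S \<noteq> 0\<close> card_poly_roots_bound[of "lift S"] by simp
  finally have "p - 1 \<le> degree S"
    using L.inj_on_of_nat by (subst (asm) card_image) (auto simp: inj_on_def)
  then have "n = 1"
    using \<open>p = degree S + n\<close> \<open>n > 0\<close> by simp
  define a b where "a = coeff M 0" and "b = coeff M 1"
  have "M = [:a, b:]"
    using M \<open>n = 1\<close> by (intro poly_eqI) (auto simp: a_def b_def coeff_pCons coeff_eq_0 split: nat.split)
  moreover have "b \<noteq> 0"
    using M \<open>n = 1\<close> by (metis b_def leading_coeff_0_iff)
  ultimately have ab: "M = [:a, b:]" "b \<noteq> 0" .
  have "\<alpha> = \<iota> (- a / b)"
    using M(2) ab by (simp add: lift_simps emb_simps field_simps eq_neg_iff_add_eq_0)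
  then show False
    using gen_notin_range by auto
qed

lemma poly_gen_eq_0_imp_dvd:
  assumes "poly (lift Q) \<alpha> = 0"
  shows "AS_poly dvd Q"
proof -
  have "AS_poly \<noteq> 0"
    using degree_AS_poly K.p_pos by auto
  have "poly (lift Q) \<alpha> = poly (lift (Q div AS_poly * AS_poly + Q mod AS_poly)) \<alpha>"
    by (simp only: div_mult_mod_eq)
  also have "\<dots> = poly (lift (Q mod AS_poly)) \<alpha>"
    using AS_poly_root[of 0] by (simp only: lift_simps) simp
  finally have "Q mod AS_poly = 0"
    using degree_mod_less'[OF \<open>AS_poly \<noteq> 0\<close>, of Q] poly_gen_nonzero degree_AS_poly assms
    by fastforce
  then show ?thesis by auto
qed

text \<open>This makes the substitution of \<alpha> + i for \<alpha> well defined on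
  \<open>L\<close>: every relation of \<alpha> over \<open>K\<close> is a multiple of
  \<open>AS_poly\<close>, which also vanishes at \<alpha> + i.\<close>

lemma poly_gen_shift_eq_0:
  assumes "poly (lift Q) \<alpha> = 0"
  shows "poly (lift Q) (\<alpha> + of_nat i) = 0"
  using poly_gen_eq_0_imp_dvd[OF assms] AS_poly_root[of i] by (auto simp: lift_simps elim!: dvdE)

lemma poly_gen_reduce: "\<exists>R. degree R < p \<and> poly (lift R) \<alpha> = poly (lift Q) \<alpha>"
proof (intro exI conjI)
  have "AS_poly \<noteq> 0"
    using degree_AS_poly K.p_pos by auto
  then show "degree (Q mod AS_poly) < p"
    using degree_mod_less'[of AS_poly Q] degree_AS_poly K.p_pos by (cases "Q mod AS_poly = 0") auto
  have "poly (lift Q) \<alpha> = poly (lift (Q div AS_poly * AS_poly + Q mod AS_poly)) \<alpha>"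
    by (simp only: div_mult_mod_eq)
  also have "\<dots> = poly (lift (Q mod AS_poly)) \<alpha>"
    using AS_poly_root[of 0] by (simp only: lift_simps) simp
  finally show "poly (lift (Q mod AS_poly)) \<alpha> = poly (lift Q) \<alpha>" ..
qed

text \<open>The fixed field of \<sigma> is \<open>K\<close>. After reduction to degree below
  \<open>p\<close>, invariance at \<alpha> becomes an identity of polynomials, and a shift-invariant
  polynomial of that degree is constant.\<close>

lemma shift_invariant_in_range:
  assumes "poly (lift Q) (\<alpha> + 1) = poly (lift Q) \<alpha>"
  shows "poly (lift Q) \<alpha> \<in> range \<iota>"
proof -
  obtain R where R: "degree R < p" "poly (lift R) \<alpha> = poly (lift Q) \<alpha>"
    using poly_gen_reduce by blast
  have "poly (lift R) (\<alpha> + 1) = poly (lift Q) (\<alpha> + 1)"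
    using poly_gen_shift_eq_0[of "R - Q" 1] R by (simp add: lift_simps)
  then have *: "poly (lift (pcompose R [:1, 1:] - R)) \<alpha> = 0"
    using assms R by (simp add: lift_simps poly_pcompose add.commute)
  have "degree (pcompose R [:1, 1:] - R) < p"
    using R by (intro degree_diff_less) auto
  then have "pcompose R [:1, 1:] - R = 0"
    using * poly_gen_nonzero by blast
  then have "R = [:poly R 0:]"
    using R K.p_gt_1 by (intro shift_invariant_imp_const[of _ 1]) auto
  then obtain c where "R = [:c:]" ..
  then show ?thesis
    using R(2) by (simp add: lift_simps flip: R(2))
qed

text \<open>Only inverses need an argument: the norm of \<open>x\<close> lies in \<open>K\<close>,
  so \<open>inverse x\<close> is the product of the other conjugates divided by the norm.\<close>

lemma exists_poly_gen: "\<exists>Q. poly (lift Q) \<alpha> = x"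
proof -
  have "x \<in> gen_field \<iota> \<alpha>"
    using gen by simp
  then show ?thesis
  proof induction
    case (base c)
    show ?case by (auto intro!: exI[of _ "[:c:]"] simp: lift_simps)
  next
    case gen
    show ?case by (auto intro!: exI[of _ "[:0, 1:]"] simp: lift_simps)
  next
    case (add x y)
    then show ?case by (metis lift_add poly_add)
  next
    case (neg x)
    then show ?case by (metis lift_uminus poly_minus)
  next
    case (mult x y)
    then show ?case by (metis lift_mult poly_mult)
  next
    case (inv x)
    show ?case
    proof (cases "x = 0")
      case False
      obtain Q where Q: "poly (lift Q) \<alpha> = x"
        using inv by blast
      define R where "R = (\<Prod>i<p. pcompose Q [:of_nat i, 1:])"
      define S where "S = (\<Prod>i\<in>{1..<p}. pcompose Q [:of_nat i, 1:])"
      have "{..<p} = insert 0 {1..<p}"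
        using K.p_pos by auto
      then have RS: "R = Q * S"
        by (simp add: R_def S_def)
      have R: "poly (lift R) (\<alpha> + of_nat j) = (\<Prod>i<p. poly (lift Q) (\<alpha> + of_nat (i + j)))" for j
        by (simp add: R_def lift_simps poly_prod poly_pcompose emb_of_nat add.commute add.left_commute)
      have "poly (lift R) (\<alpha> + 1) = poly (lift R) \<alpha>"
        using prod_Suc_mod_shift[of "\<lambda>i. poly (lift Q) (\<alpha> + of_nat i)" p] R[of 1] R[of 0] by simp
      then obtain c where c: "poly (lift R) \<alpha> = \<iota> c"
        using shift_invariant_in_range by blast
      \<comment> \<open>A vanishing conjugate, shifted by the remaining \<open>p - i\<close>, would
        return to \<open>x\<close> itself and make it zero.\<close>
      have "poly (lift Q) (\<alpha> + of_nat i) \<noteq> 0" if "i < p" for i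
      proof
        assume "poly (lift Q) (\<alpha> + of_nat i) = 0"
        then have "poly (lift (pcompose Q [:of_nat i, 1:])) \<alpha> = 0"
          by (simp add: lift_simps poly_pcompose emb_of_nat add.commute)
        then have "poly (lift (pcompose Q [:of_nat i, 1:])) (\<alpha> + of_nat (p - i)) = 0"
          by (rule poly_gen_shift_eq_0)
        then have "poly (lift Q) (\<alpha> + of_nat (p - i + i)) = 0"
          unfolding lift_simps poly_pcompose of_nat_add by (simp add: emb_of_nat algebra_simps)
        then show False
          using that Q False by simp
      qed
      then have "\<iota> c \<noteq> 0"
        using R[of 0] c by simp
      moreover have "x * poly (lift S) \<alpha> = \<iota> c"
        using c Q by (simp add: RS lift_simps)
      ultimately have "poly (lift (smult (inverse c) S)) \<alpha> = inverse x"
        using False by (simp add: lift_simps emb_simps field_simps)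
      then show ?thesis by blast
    qed (auto intro: exI[of _ 0])
  qed
qed

section \<open>The automorphism \<sigma> and its powers\<close>

definition \<sigma> :: "'l \<Rightarrow> 'l" where
  "\<sigma> x = poly (lift (SOME Q. poly (lift Q) \<alpha> = x)) (\<alpha> + 1)"

text \<open>The choice in \<sigma> is harmless: two polynomials representing the same element differ
  by one that vanishes at \<alpha>, hence also at \<alpha> + 1.\<close>

lemma \<sigma>_poly_gen: "\<sigma> (poly (lift Q) \<alpha>) = poly (lift Q) (\<alpha> + 1)"
proof -
  define R where "R = (SOME R. poly (lift R) \<alpha> = poly (lift Q) \<alpha>)"
  have "poly (lift R) \<alpha> = poly (lift Q) \<alpha>"
    unfolding R_def by (rule someI_ex) blast
  then show ?thesis
    using poly_gen_shift_eq_0[of "R - Q" 1] by (simp add: lift_simps \<sigma>_def flip: R_def)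
qed

lemma \<sigma>_emb [simp]: "\<sigma> (\<iota> c) = \<iota> c"
  using \<sigma>_poly_gen[of "[:c:]"] by (simp add: lift_simps)

lemma \<sigma>_gen: "\<sigma> \<alpha> = \<alpha> + 1"
  using \<sigma>_poly_gen[of "[:0, 1:]"] by (simp add: lift_simps)

sublocale \<sigma>: field_embedding \<sigma>
proof
  have "\<sigma> (x + y) = \<sigma> x + \<sigma> y \<and> \<sigma> (x * y) = \<sigma> x * \<sigma> y" for x y
  proof -
    obtain P Q where "poly (lift P) \<alpha> = x" "poly (lift Q) \<alpha> = y"
      using exists_poly_gen by metis
    then show ?thesis
      using \<sigma>_poly_gen[of "P + Q"] \<sigma>_poly_gen[of "P * Q"]
      by (auto simp: lift_simps \<sigma>_poly_gen)
  qed
  then show "field_emb \<sigma>"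
    using \<sigma>_emb[of 1] unfolding field_emb_def by simp
qed

lemma \<sigma>_fixed_iff: "\<sigma> x = x \<longleftrightarrow> x \<in> range \<iota>"
proof
  assume "\<sigma> x = x"
  moreover obtain Q where "poly (lift Q) \<alpha> = x"
    using exists_poly_gen by blast
  ultimately show "x \<in> range \<iota>"
    using shift_invariant_in_range[of Q] \<sigma>_poly_gen[of Q] by auto
qed auto

lemma \<sigma>_pow_poly_gen: "(\<sigma> ^^ i) (poly (lift Q) \<alpha>) = poly (lift Q) (\<alpha> + of_nat i)"
proof (induction i)
  case (Suc i)
  have "(\<sigma> ^^ Suc i) (poly (lift Q) \<alpha>) = \<sigma> (poly (lift (pcompose Q [:of_nat i, 1:])) \<alpha>)"
    using Suc by (simp add: lift_simps poly_pcompose emb_of_nat add.commute)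
  then show ?case
    unfolding \<sigma>_poly_gen by (simp add: lift_simps poly_pcompose emb_of_nat algebra_simps)
qed auto

lemma \<sigma>_pow_p [simp]: "(\<sigma> ^^ p) x = x"
  using exists_poly_gen[of x] \<sigma>_pow_poly_gen[of p] by auto

lemma field_embedding_\<sigma>_pow: "field_embedding (\<sigma> ^^ i)"
  unfolding field_embedding_def field_emb_def
  by (induction i) (auto simp: \<sigma>.emb_add \<sigma>.emb_mult)

lemma \<sigma>_pow_emb [simp]: "(\<sigma> ^^ i) (\<iota> c) = \<iota> c"
  by (induction i) auto

lemma \<sigma>_pow_mod: "(\<sigma> ^^ (i mod p)) x = (\<sigma> ^^ i) x"
proof -
  have "(\<sigma> ^^ (p * j)) x = x" for j
    by (induction j) (auto simp: funpow_add)
  then show ?thesis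
    by (metis comp_apply funpow_add mod_mult_div_eq)
qed

lemma exists_lift_if_\<sigma>_fixed:
  assumes "\<sigma>.lift Q = Q"
  shows "\<exists>P. lift P = Q"
proof -
  have "\<exists>c. \<iota> c = coeff Q i" for i
    using assms \<sigma>_fixed_iff[of "coeff Q i"] \<sigma>.coeff_lift[of Q i] by auto
  then obtain c where "\<And>i. \<iota> (c i) = coeff Q i"
    by metis
  then have "inv \<iota> (coeff Q i) = c i" for i
    by (metis emb_eq_iff injI inv_f_f)
  then have "lift (map_poly (inv \<iota>) Q) = Q"
    using \<open>\<And>i. \<iota> (c i) = coeff Q i\<close> by (intro poly_eqI) (metis coeff_lift coeff_map_poly emb_zero inv_f_f emb_eq_iff injI)
  then show ?thesis ..
qed

text \<open>\<sigma> has order dividing \<open>p\<close>, so it permutes the linear factors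
  cyclically and fixes the coefficients of the product.\<close>

lemma exists_char_poly: "\<exists>P. lift P = (\<Prod>i<p. [:- (\<sigma> ^^ i) x, 1:])"
proof (rule exists_lift_if_\<sigma>_fixed)
  have "\<sigma>.lift (\<Prod>i<p. [:- (\<sigma> ^^ i) x, 1:]) = (\<Prod>i<p. [:- (\<sigma> ^^ Suc i) x, 1:])"
    by (simp add: \<sigma>.lift_simps \<sigma>.emb_simps)
  then show "\<sigma>.lift (\<Prod>i<p. [:- (\<sigma> ^^ i) x, 1:]) = (\<Prod>i<p. [:- (\<sigma> ^^ i) x, 1:])"
    using prod_Suc_mod_shift[of "\<lambda>i. [:- (\<sigma> ^^ i) x, 1:]" p] by simp
qed

end

section \<open>Uniqueness of the extended valuation\<close>

text \<open>\<open>V\<close> is any valuation ring of \<open>L\<close> lying over \<open>A\<close>;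
  its uniqueness is a consequence, obtained in \<open>int_closure_eq\<close>.\<close>

locale AS_val = AS_ext \<iota> p \<alpha> f + A: valring A + V: valring V
  for \<iota> :: "'k::field \<Rightarrow> 'l::field" and p :: nat and \<alpha> f and A :: "'k set" and V :: "'l set" +
  assumes henselian: "henselian A" and vimage_V: "\<iota> -` V = A"
begin

lemma emb_mem_iff [simp]: "\<iota> c \<in> V \<longleftrightarrow> c \<in> A"
  using vimage_V by auto

lemma emb_le_iff [simp]: "V.le (\<iota> x) (\<iota> y) \<longleftrightarrow> A.le x y"
  by (auto simp: V.le_def A.le_def val_ge_def simp flip: emb_divide)

lemma emb_lt_iff [simp]: "V.lt (\<iota> x) (\<iota> y) \<longleftrightarrow> A.lt x y"
  by (simp add: V.lt_def A.lt_def)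

lemma one_le_emb_iff [simp]: "V.le 1 (\<iota> y) \<longleftrightarrow> A.le 1 y" "V.le (\<iota> y) 1 \<longleftrightarrow> A.le y 1"
    "V.lt 1 (\<iota> y) \<longleftrightarrow> A.lt 1 y" "V.lt (\<iota> y) 1 \<longleftrightarrow> A.lt y 1"
  using emb_le_iff[of 1 y] emb_le_iff[of y 1] emb_lt_iff[of 1 y] emb_lt_iff[of y 1] by simp_all

lemma henselian_lift:
  assumes "\<And>i. coeff P i \<in> A" "lead_coeff P = 1" "a \<in> A" "A.lt (poly P a) 1" "A.le 1 (poly (pderiv P) a)"
  shows "\<exists>b. poly P b = 0"
  using assms henselian unfolding henselian_def A.max_ideal_iff A.lt_def by blast

definition s :: "nat \<Rightarrow> 'l \<Rightarrow> 'l" where "s i = \<sigma> ^^ i"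

sublocale s: field_embedding "s i" for i
  unfolding s_def by (rule field_embedding_\<sigma>_pow)

lemma s_zero [simp]: "s 0 x = x" and s_one [simp]: "s (Suc 0) x = \<sigma> x" and s_p [simp]: "s p x = x"
  and s_emb [simp]: "s i (\<iota> c) = \<iota> c" and s_mod: "s (i mod p) x = s i x" and s_add: "s i (s j x) = s (i + j) x"
  by (simp_all add: s_def \<sigma>_pow_mod funpow_add)

lemma s_inverse: "i < p \<Longrightarrow> s (p - i) (s i x) = x"
  by (simp add: s_add)

lemma \<sigma>_s: "\<sigma> (s i x) = s (Suc i) x"
  by (simp add: s_def)

text \<open>Serves to return from \<open>s i\<close> to \<sigma>, and from \<open>z ^ e\<close> to
  \<open>z\<close> up to powers of \<open>z ^ p\<close>.\<close>

lemma exists_mult_eq_one_mod: "0 < i \<Longrightarrow> i < p \<Longrightarrow> \<exists>k. (k * i) mod p = 1"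
proof -
  assume "0 < i" "i < p"
  then have "coprime i p"
    using K.prime by (metis coprime_commute nat_dvd_not_less prime_imp_coprime_nat)
  then obtain k where "[i * k = 1] (mod p)"
    using cong_solve_coprime_nat[of i p] by auto
  then show ?thesis
    using K.p_gt_1 by (auto simp: cong_def mult.commute)
qed

lemma exists_normalized_poly:
  assumes "P \<noteq> (0 :: 'k poly)"
  shows "\<exists>c m. c \<noteq> 0 \<and> (\<forall>i. coeff (smult c P) i \<in> A) \<and> coeff (smult c P) m = 1"
proof -
  obtain m where m: "\<And>i. i \<le> degree P \<Longrightarrow> A.le (coeff P i) (coeff P m)"
    using A.exists_max[of "{..degree P}" "coeff P"] by auto
  have "coeff P m \<noteq> 0"
    using m[of "degree P"] assms by auto
  moreover have "inverse (coeff P m) * coeff P i \<in> A" for i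
    using m[of i] calculation
    by (cases "i \<le> degree P") (auto simp: A.le_def val_ge_def coeff_eq_0 field_simps)
  ultimately show ?thesis
    by (intro exI[of _ "inverse (coeff P m)"] exI[of _ m]) simp
qed

lemma char_poly:
  obtains P where "lift P = (\<Prod>i<p. [:- s i x, 1:])" "degree P = p" "lead_coeff P = 1" "P \<noteq> 0"
proof -
  obtain P where P: "lift P = (\<Prod>i<p. [:- s i x, 1:])"
    using exists_char_poly[of x] unfolding s_def by blast
  have "degree (lift P) = p"
    unfolding P by (subst degree_prod_eq_sum_degree) auto
  moreover have "lead_coeff (lift P) = 1"
    unfolding P lead_coeff_prod by simp
  moreover have "\<iota> (lead_coeff P) = lead_coeff (lift P)"
    by simp
  ultimately have "degree P = p" "lead_coeff P = 1"
    by (simp_all del: coeff_lift flip: emb_one) 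
  then show ?thesis
    using that P by force
qed

text \<open>If \<open>V\<close> and its conjugate by \<open>s i\<close> differ, the Horner sums of a polynomial over \<open>A\<close> with a unit
  coefficient and a root \<open>z\<close> in \<open>V\<close> only separate the centres of the two valuation rings on the
  intersection of all conjugates.\<close>

lemma exists_separating:
  assumes "z \<in> V" "s i z \<notin> V"
  shows "\<exists>b. (\<forall>j. s j b \<in> V) \<and> V.le 1 b \<and> V.lt (s i b) 1"
proof -
  obtain P0 where P0: "lift P0 = (\<Prod>i<p. [:- s i z, 1:])" "P0 \<noteq> 0"
    by (rule char_poly)
  have "poly (lift P0) z = 0"
    unfolding P0 poly_prod using K.p_pos by (auto intro!: prod_zero bexI[of _ 0])
  moreover obtain c m where cm: "c \<noteq> 0" "\<And>i. coeff (smult c P0) i \<in> A" "coeff (smult c P0) m = 1"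
    using exists_normalized_poly[OF P0(2)] by blast
  define P where "P = smult c P0"
  ultimately have root: "poly (lift P) z = 0"
    by (simp add: lift_simps)
  have P: "coeff P i \<in> A" "coeff P m = 1" for i
    using cm by (auto simp: P_def)
  \<comment> \<open>The Horner sums: \<open>d k\<close> is the value at \<open>z\<close> of
    \<open>P\<close> with its lowest \<open>k\<close> terms removed and the rest shifted
    down.\<close>
  define d where "d k = poly (lift (poly_shift k P)) z" for k
  have "poly_shift k P = pCons (coeff P k) (poly_shift (Suc k) P)" for k
    by (intro poly_eqI) (simp add: coeff_poly_shift coeff_pCons split: nat.split)
  then have d_rec: "d k = \<iota> (coeff P k) + z * d (Suc k)" for k
    unfolding d_def by (metis lift_pCons poly_pCons)
  have d_0: "d 0 = 0"
    using root by (simp add: d_def poly_shift_id[unfolded id_def])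
  \<comment> \<open>At a conjugate in \<open>V\<close> both claims hold by evaluation. Otherwise the
    Horner recursion is run upwards from \<open>d 0 = 0\<close>, dividing by \<open>s j z\<close> at
    each step.\<close>
  have mem: "s j (d (Suc k)) \<in> V \<and> s j (z * d (Suc k)) \<in> V" for j k
  proof (cases "s j z \<in> V")
    case True
    have "s j (d (Suc k)) = poly (lift (poly_shift (Suc k) P)) (s j z)"
      unfolding d_def by (simp add: poly_altdef s.emb_simps)
    also have "\<dots> \<in> V"
      using True P by (intro V.poly_mem) (auto simp: coeff_poly_shift)
    finally show ?thesis
      using True by (auto simp: s.emb_mult intro: V.mult_mem)
  next
    case False
    then have "z \<noteq> 0"
      by auto
    then have inv: "inverse (s j z) \<in> V" "s j z \<noteq> 0"
      using False V.mem_or_inverse_mem[of "s j z"] by auto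
    have step: "s j (d (Suc k)) \<in> V \<and> s j (z * d (Suc k)) \<in> V" if "s j (d k) \<in> V" for k
    proof -
      have eq: "z * d (Suc k) = d k - \<iota> (coeff P k)"
        using d_rec[of k] by simp
      then have "s j (z * d (Suc k)) \<in> V"
        using that P by (auto simp: s.emb_diff intro: V.diff_mem)
      moreover have "s j (d (Suc k)) = inverse (s j z) * s j (z * d (Suc k))"
        using inv by (simp add: s.emb_mult)
      ultimately show ?thesis
        using inv by (auto intro: V.mult_mem)
    qed
    show ?thesis
    proof (induction k)
      case 0
      then show ?case using step[of 0] d_0 by simp
    next
      case (Suc k)
      then show ?case using step[of "Suc k"] by simp
    qed
  qed
  \<comment> \<open>If all these sums were small, so would be \<open>d m - z * d (Suc m)\<close>,
    which is the unit coefficient 1.\<close>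
  have "\<exists>k. V.le 1 (d (Suc k))"
  proof (rule ccontr)
    assume "\<not> (\<exists>k. V.le 1 (d (Suc k)))"
    then have lt: "V.lt (d (Suc k)) 1" for k
      by (simp add: V.lt_def)
    then have "V.lt (d m) 1"
      using d_0 by (cases m) auto
    moreover have "V.lt (z * d (Suc m)) (1 * 1)"
      using assms(1) lt by (intro V.le_mult_lt) (auto simp: V.le_one_iff)
    moreover have "1 = d m - z * d (Suc m)"
      using d_rec[of m] P by simp
    ultimately show False
      using V.lt_diff[of "d m" 1 "z * d (Suc m)"] by simp
  qed
  then obtain k where k: "V.le 1 (d (Suc k))"
    by blast
  \<comment> \<open>The product \<open>z * d (Suc k)\<close> stays in \<open>V\<close> under
    \<open>s i\<close>, while \<open>s i z\<close> does not; the other factor must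
    compensate.\<close>
  have "V.lt (s i (d (Suc k))) 1"
  proof -
    have nz: "s i z \<noteq> 0"
      using assms by auto
    have "V.le (s i (d (Suc k)) * s i z) 1"
      using mem[of i k] by (simp add: V.le_one_iff s.emb_mult mult.commute)
    also have "V.lt 1 (1 * s i z)"
      using assms by (simp add: V.lt_def V.le_one_iff)
    finally show ?thesis
      unfolding V.lt_mult_right_iff[OF nz] .
  qed
  then show ?thesis
    using mem k by blast
qed

lemma sum_conjugates_in_range: "(\<Sum>i<p. s i x) \<in> range \<iota>"
proof -
  have "\<sigma> (\<Sum>i<p. s i x) = (\<Sum>i<p. s (Suc i) x)"
    by (simp add: \<sigma>.emb_sum \<sigma>_s)
  also have "\<dots> = (\<Sum>i<p. s i x)"
    using sum.lessThan_Suc_shift[of "\<lambda>i. s i x" p] by (simp add: add.commute)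
  finally show ?thesis
    by (simp flip: \<sigma>_fixed_iff)
qed

lemma coeff_char_poly_mem:
  assumes "lift P = (\<Prod>i<p. [:- s i x, 1:])" "\<And>i. s i x \<in> V"
  shows "coeff P k \<in> A"
proof -
  have "coeff (lift P) k \<in> V"
    unfolding assms(1) using assms(2)
    by (intro V.coeff_prod_mem) (auto simp: coeff_pCons V.uminus_mem split: nat.split)
  then show ?thesis
    by simp
qed


lemma exists_separating_all:
  assumes "\<And>i. 0 < i \<Longrightarrow> i < p \<Longrightarrow> \<exists>z\<in>V. s i z \<notin> V"
  shows "\<exists>x. (\<forall>j. s j x \<in> V) \<and> V.le 1 x \<and> (\<forall>i. 0 < i \<and> i < p \<longrightarrow> V.lt (s i x) 1)"
proof -
  have "\<exists>b. (\<forall>j. s j b \<in> V) \<and> V.le 1 b \<and> V.lt (s i b) 1" if i: "i \<in> {1..<p}" for i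
  proof -
    obtain z where "z \<in> V" "s i z \<notin> V"
      using assms[of i] i by auto
    then show ?thesis
      by (rule exists_separating)
  qed
  then obtain b where b: "\<And>i j. i \<in> {1..<p} \<Longrightarrow> s j (b i) \<in> V"
      "\<And>i. i \<in> {1..<p} \<Longrightarrow> V.le 1 (b i)" "\<And>i. i \<in> {1..<p} \<Longrightarrow> V.lt (s i (b i)) 1"
    by metis
  define x where "x = (\<Prod>i\<in>{1..<p}. b i)"
  have s_x: "s j x = (\<Prod>i\<in>{1..<p}. s j (b i))" for j
    by (simp add: x_def s.prod_emb)
  have "s j x \<in> V" for j
    unfolding s_x using b by (intro V.prod_mem)
  moreover have "V.le 1 x"
    unfolding x_def using b(2) by (rule V.one_le_prod)
  moreover have "V.lt (s i x) 1" if i: "0 < i" "i < p" for i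
  proof -
    have i: "i \<in> {1..<p}"
      using i by auto
    have "V.lt (s i (b i) * (\<Prod>k\<in>{1..<p} - {i}. s i (b k))) (1 * 1)"
      using b i by (intro V.lt_mult_le) (auto simp: V.le_one_iff intro!: V.prod_mem)
    then show ?thesis
      using i unfolding s_x by (subst prod.remove[of _ i]) auto
  qed
  ultimately show ?thesis
    by blast
qed

text \<open>\<open>s i\<close> generates the whole group, so stability under it passes to its power
  \<sigma>.\<close>

lemma exists_conjugate_stable:
  assumes i: "0 < i" "i < p" and stable: "\<And>z. z \<in> V \<Longrightarrow> s i z \<in> V" and "z \<in> V"
  shows "\<sigma> z \<in> V"
proof -
  obtain k where k: "(k * i) mod p = 1"
    using exists_mult_eq_one_mod i by blast
  have "s (k * i) z \<in> V" for k
  proof (induction k)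
    case (Suc k)
    then show ?case
      using stable[of "s (k * i) z"] by (simp add: s_add add.commute)
  qed (use assms in auto)
  then show ?thesis
    using s_mod[of "k * i" z] k by (metis One_nat_def s_one)
qed

text \<open>Otherwise the conjugates of \<open>V\<close> are pairwise distinct, and an element \<open>y\<close> with \<open>y \<equiv> 1\<close> whose
  other conjugates are \<open>\<equiv> 0\<close> has a characteristic polynomial congruent to \<open>T ^ (p - 1) * (T - 1)\<close>,
  contradicting Hensel's lemma.\<close>

lemma \<sigma>_mem:
  assumes "z \<in> V"
  shows "\<sigma> z \<in> V"
proof (rule ccontr)
  assume "\<sigma> z \<notin> V"
  then have "\<exists>z\<in>V. s i z \<notin> V" if "0 < i" "i < p" for i
    using exists_conjugate_stable[OF that] assms by blast
  then obtain x where x: "\<And>j. s j x \<in> V" "V.le 1 x" "\<And>i. 0 < i \<Longrightarrow> i < p \<Longrightarrow> V.lt (s i x) 1"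
    using exists_separating_all by metis
  \<comment> \<open>The trace of \<open>x\<close> is a unit at \<open>V\<close> congruent to
    \<open>x\<close>. Dividing by it, a scalar from \<open>K\<close>, makes \<open>y\<close>
    congruent to 1 and keeps the other conjugates small.\<close>
  obtain c where c: "(\<Sum>i<p. s i x) = \<iota> c"
    using sum_conjugates_in_range by blast
  define r where "r = (\<Sum>i\<in>{1..<p}. s i x)"
  have "{..<p} = insert 0 {1..<p}"
    using K.p_pos by auto
  then have xr: "\<iota> c = x + r"
    by (simp add: r_def flip: c)
  have r: "V.lt r 1"
    unfolding r_def using x by (intro V.lt_sum) auto
  have "V.le x (\<iota> c)"
    unfolding xr using V.le_add_lt[of r x] V.lt_le_trans[OF r x(2)] by (simp add: add.commute)
  then have one_le_c: "V.le 1 (\<iota> c)"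
    using x(2) V.le_trans by blast
  then have "c \<noteq> 0"
    by auto
  then have c_inv: "inverse (\<iota> c) \<in> V"
    using one_le_c by (simp add: V.le_def val_ge_def inverse_eq_divide)
  define y where "y = x * inverse (\<iota> c)"
  have s_y: "s j y = s j x * inverse (\<iota> c)" for j
    by (simp add: y_def s.emb_simps)
  have y_mem: "s j y \<in> V" for j
    unfolding s_y using x c_inv by (intro V.mult_mem)
  have y_lt: "V.lt (s i y) 1" if "0 < i" "i < p" for i
  proof -
    have "V.lt (s i x * inverse (\<iota> c)) (1 * 1)"
      using c_inv x(3) that by (intro V.lt_mult_le) (auto simp: V.le_one_iff)
    then show ?thesis
      by (simp add: s_y)
  qed
  have "1 - y = (\<iota> c - x) * inverse (\<iota> c)"
    using \<open>c \<noteq> 0\<close> by (simp add: y_def left_diff_distrib)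
  then have "1 - y = r * inverse (\<iota> c)"
    by (simp add: xr)
  moreover have "V.lt (r * inverse (\<iota> c)) (1 * 1)"
    using c_inv r by (intro V.lt_mult_le) (auto simp: V.le_one_iff)
  ultimately have y_1: "V.lt (1 - y) 1"
    by simp
  obtain P where P: "lift P = (\<Prod>i<p. [:- s i y, 1:])" "lead_coeff P = 1"
    by (rule char_poly)
  define R where "R = (\<Prod>i\<in>{1..<p}. [:- s i y, 1:])"
  have lift_P: "lift P = [:- y, 1:] * R"
    by (simp add: P(1) R_def \<open>{..<p} = _\<close>)
  have R_mem: "coeff R i \<in> V" for i
    unfolding R_def using y_mem
    by (intro V.coeff_prod_mem) (auto simp: coeff_pCons V.uminus_mem split: nat.split)
  have R_1: "V.le 1 (poly R 1)"
  proof -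
    have "V.le 1 (1 - s i y)" if "i \<in> {1..<p}" for i
      using V.le_add_lt[of "- s i y" 1] y_lt[of i] that by simp
    then show ?thesis
      unfolding R_def poly_prod by (intro V.one_le_prod) simp
  qed
  \<comment> \<open>Modulo the maximal ideal 1 is a simple root: \<open>y\<close> is congruent to 1,
    and the cofactor \<open>R\<close> takes at 1 a product of units
    \<open>1 - s i y\<close>.\<close>
  have "\<exists>b. poly P b = 0"
  proof (rule henselian_lift)
    show "coeff P i \<in> A" for i
      using coeff_char_poly_mem P y_mem by blast
    have "\<iota> (poly P 1) = poly (lift P) 1"
      by (metis emb_one poly_lift_emb)
    also have "\<dots> = (1 - y) * poly R 1"
      by (simp add: lift_P algebra_simps)
    also have "V.lt \<dots> (1 * 1)"
      using y_1 R_mem by (intro V.lt_mult_le) (auto simp: V.le_one_iff intro!: V.poly_mem)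
    finally show "A.lt (poly P 1) 1"
      by simp
    have "pderiv (lift P) = [:- y, 1:] * pderiv R + R"
      unfolding lift_P by (simp add: pderiv_pCons pderiv_diff pderiv_smult)
    then have "poly (lift (pderiv P)) 1 = poly ([:- y, 1:] * pderiv R + R) 1"
      by (simp only: lift_pderiv)
    also have "\<dots> = (1 - y) * poly (pderiv R) 1 + poly R 1"
      by (simp add: algebra_simps)
    finally have "\<iota> (poly (pderiv P) 1) = (1 - y) * poly (pderiv R) 1 + poly R 1"
      by (metis emb_one poly_lift_emb)
    moreover have "V.le (poly R 1) ((1 - y) * poly (pderiv R) 1 + poly R 1)"
    proof (rule V.le_add_lt)
      have "V.lt ((1 - y) * poly (pderiv R) 1) (1 * 1)"
        using y_1 R_mem 
        by (intro V.lt_mult_le)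
          (auto simp: V.le_one_iff coeff_pderiv simp del: of_nat_Suc intro!: V.poly_mem V.mult_mem V.of_nat_mem)
      then show "V.lt ((1 - y) * poly (pderiv R) 1) (poly R 1)"
        using R_1 V.lt_le_trans by simp
    qed
    ultimately show "A.le 1 (poly (pderiv P) 1)"
      using R_1 V.le_trans by (metis one_le_emb_iff(1))
  qed (use P in auto)
  \<comment> \<open>The root found in \<open>K\<close> is a conjugate of \<open>y\<close>, hence
    \<open>y\<close> itself; then \<open>y\<close> equals its other conjugates, which are small,
    although \<open>y\<close> is congruent to 1.\<close>
  then obtain b where "poly (lift P) (\<iota> b) = 0"
    by auto
  then obtain i where i: "i < p" "\<iota> b = s i y"
    unfolding P poly_prod by auto
  then have "y = \<iota> b"
    using s_inverse[of i y] by (metis s_emb)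
  then have "V.lt y 1"
    using y_lt[of 1] K.p_gt_1 by simp
  then show False
    using V.lt_add[OF y_1, of y] by simp
qed

lemma s_mem: "z \<in> V \<Longrightarrow> s i z \<in> V"
  by (induction i) (auto simp: \<sigma>_mem simp flip: \<sigma>_s)

lemma s_mem_iff [simp]: "s i z \<in> V \<longleftrightarrow> z \<in> V"
proof
  assume "s i z \<in> V"
  then have "s (i mod p) z \<in> V"
    by (simp add: s_mod)
  then have "s (p - i mod p) (s (i mod p) z) \<in> V"
    by (rule s_mem)
  then show "z \<in> V"
    using K.p_pos by (simp add: s_inverse)
qed (rule s_mem)

lemma s_le_iff [simp]: "V.le (s i x) (s i y) \<longleftrightarrow> V.le x y"
  by (auto simp: V.le_def val_ge_def simp flip: s.emb_divide)

lemma s_lt_iff [simp]: "V.lt (s i x) (s i y) \<longleftrightarrow> V.lt x y"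
  by (simp add: V.lt_def)

lemma s_one_iff [simp]: "V.le 1 (s i x) \<longleftrightarrow> V.le 1 x" "V.le (s i x) 1 \<longleftrightarrow> V.le x 1"
  "V.lt 1 (s i x) \<longleftrightarrow> V.lt 1 x" "V.lt (s i x) 1 \<longleftrightarrow> V.lt x 1"
  using s_le_iff[of i 1 x] s_le_iff[of i x 1] s_lt_iff[of i 1 x] s_lt_iff[of i x 1] by simp_all

lemma int_closure_eq: "int_closure \<iota> A = V"
proof
  show "int_closure \<iota> A \<subseteq> V"
  proof
    fix x assume "x \<in> int_closure \<iota> A"
    then obtain P where "\<forall>i. coeff P i \<in> A" "lead_coeff P = 1" "poly (lift P) x = 0"
      by (auto simp: int_closure_def)
    then show "x \<in> V"
      by - (rule V.integral_mem[of "lift P"], simp_all)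
  qed
  show "V \<subseteq> int_closure \<iota> A"
  proof
    fix x assume "x \<in> V"
    obtain P where P: "lift P = (\<Prod>i<p. [:- s i x, 1:])" "lead_coeff P = 1"
      by (rule char_poly)
    have "poly (lift P) x = 0"
      unfolding P poly_prod using K.p_pos by (auto intro!: prod_zero bexI[of _ 0])
    moreover have "coeff P i \<in> A" for i
      using coeff_char_poly_mem[OF P(1)] \<open>x \<in> V\<close> by simp
    ultimately show "x \<in> int_closure \<iota> A"
      using P(2) unfolding int_closure_def by blast
  qed
qed

lemma prod_conjugates_in_range: "(\<Prod>i<p. s i x) \<in> range \<iota>"
proof -
  have "\<sigma> (\<Prod>i<p. s i x) = (\<Prod>i<p. s (Suc i) x)"
    by (simp add: \<sigma>.prod_emb \<sigma>_s)
  also have "\<dots> = (\<Prod>i<p. s i x)"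
    by (rule prod_Suc_mod_shift) simp
  finally show ?thesis
    by (simp flip: \<sigma>_fixed_iff)
qed

end

section \<open>Bases adapted to the valuation\<close>

context AS_val
begin

lemma emb_sim_iff [simp]: "V.sim (\<iota> x) (\<iota> y) \<longleftrightarrow> A.sim x y"
  by (simp add: V.sim_def A.sim_def)

lemma s_Suc: "s (Suc k) x = s k (\<sigma> x)"
  by (simp add: s_def funpow_Suc_right del: funpow.simps)

lemma le_s_power: "V.le x (\<sigma> x) \<Longrightarrow> V.le x (s k x)"
proof (induction k)
  case (Suc k)
  then have "V.le (s k x) (s (Suc k) x)"
    by (simp add: s_Suc)
  then show ?case
    using Suc V.le_trans by blast
qed auto

text \<open>An increase from \<open>x\<close> to \<open>\<sigma> x\<close> would persist along the
  cycle of conjugates, which returns to \<open>x\<close> after \<open>p\<close> steps.\<close>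

lemma le_\<sigma>: "V.le (\<sigma> x) x"
proof (rule ccontr)
  assume lt: "\<not> V.le (\<sigma> x) x"
  then have "V.le x (s (p - 1) x)"
    using V.le_total le_s_power by blast
  then have "V.le (s 1 x) (s 1 (s (p - 1) x))"
    by (simp only: s_le_iff)
  then show False
    using lt K.p_gt_1 by (simp add: s_add)
qed

lemma sim_s: "V.sim (s i x) x"
proof (induction i)
  case (Suc i)
  have "V.le (s i x) (\<sigma> (s i x))"
  proof -
    have "V.le (s k y) y" for k y
      by (induction k) (use V.le_trans le_\<sigma> in \<open>auto simp flip: \<sigma>_s\<close>)
    then have "V.le (s (p - 1) (\<sigma> (s i x))) (\<sigma> (s i x))" .
    then show ?thesis
      using K.p_gt_1 by (simp add: \<sigma>_s s_add)
        (metis One_nat_def Suc_pred K.p_pos add_Suc_right add.commute s_add s_p)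
  qed
  then have "V.sim (s (Suc i) x) (s i x)"
    using le_\<sigma>[of "s i x"] by (simp add: V.sim_def \<sigma>_s)
  then show ?case
    using Suc V.sim_trans by blast
qed auto

text \<open>The norm lies in \<open>K\<close> and is a product of \<open>p\<close> conjugates of
  equal value.\<close>

lemma exists_sim_power_p: "\<exists>c. V.sim (z ^ p) (\<iota> c)"
proof -
  obtain c where c: "(\<Prod>i<p. s i z) = \<iota> c"
    using prod_conjugates_in_range by blast
  have "V.sim (\<Prod>i<p. s i z) (\<Prod>i<p. z)"
    by (intro V.sim_prod sim_s)
  then show ?thesis
    using V.sim_sym unfolding c by auto
qed

section \<open>Elements with a new value\<close>

definition ramified_elem :: "'l \<Rightarrow> bool" where
  "ramified_elem z \<longleftrightarrow> (\<forall>c. \<not> V.sim z (\<iota> c))"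

lemma ramified_elem_nonzero: "ramified_elem z \<Longrightarrow> z \<noteq> 0"
  unfolding ramified_elem_def using emb_zero V.sim_refl by metis

text \<open>Otherwise \<open>z ^ (j - i)\<close> has a value from \<open>K\<close>. So has
  \<open>z ^ p\<close>, and since \<open>j - i\<close> is invertible modulo \<open>p\<close>, the
  element \<open>z\<close> itself would have one.\<close>

lemma ramified_elem_powers:
  assumes z: "ramified_elem z" and "i < j" "j < p" "V.sim (\<iota> c * z ^ i) (\<iota> d * z ^ j)"
  shows "d = 0"
proof (rule ccontr)
  assume "d \<noteq> 0"
  have nz: "z \<noteq> 0"
    using z by (rule ramified_elem_nonzero)
  define e where "e = j - i"
  have "0 < e" "e < p"
    using assms by (auto simp: e_def)
  then obtain k where k: "(k * e) mod p = 1"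
    using exists_mult_eq_one_mod by blast
  define q where "q = (k * e) div p"
  have ke: "k * e = p * q + 1"
    using mult_div_mod_eq[of p "k * e"] k by (simp add: q_def)
  have "z ^ j = z ^ e * z ^ i"
    using assms by (simp add: e_def flip: power_add)
  then have "V.sim (\<iota> c * z ^ i) ((\<iota> d * z ^ e) * z ^ i)"
    using assms(4) by (simp add: mult.assoc)
  then have "V.sim (\<iota> c) (\<iota> d * z ^ e)"
    using nz by (simp add: V.sim_def)
  then have "V.sim (\<iota> (c / d)) (z ^ e)"
    using \<open>d \<noteq> 0\<close> by (simp add: emb_divide V.sim_divide_iff mult.commute)
  then have "V.sim (\<iota> (c / d) ^ k) ((z ^ e) ^ k)"
    by (rule V.sim_power)
  also have "(z ^ e) ^ k = (z ^ p) ^ q * z"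
    using ke by (simp flip: power_mult power_Suc2 add: mult.commute)
  finally have 1: "V.sim (\<iota> ((c / d) ^ k)) ((z ^ p) ^ q * z)"
    by (simp add: emb_power)
  obtain n where n: "V.sim (z ^ p) (\<iota> n)"
    using exists_sim_power_p by blast
  then have "n \<noteq> 0"
    using nz by auto
  have "V.sim ((z ^ p) ^ q * z) (\<iota> n ^ q * z)"
    using n by (intro V.sim_mult V.sim_power) auto
  then have "V.sim (\<iota> ((c / d) ^ k)) (z * \<iota> (n ^ q))"
    using 1 V.sim_trans by (metis emb_power mult.commute)
  then have "V.sim (\<iota> ((c / d) ^ k / n ^ q)) z"
    using \<open>n \<noteq> 0\<close> by (simp add: V.sim_divide_iff emb_divide)
  then show False
    using z V.sim_sym unfolding ramified_elem_def by blast
qed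

text \<open>An orthogonal basis in the sense of valuations; linear independence is implied by the
  inequality. The normalisation \<open>z 0 = 1\<close> lets subtraction of an element of
  \<open>K\<close> affect only the coefficient with index 0.\<close>

definition valuation_basis :: "(nat \<Rightarrow> 'l) \<Rightarrow> bool" where
  "valuation_basis z \<longleftrightarrow> z 0 = 1 \<and> (\<forall>i<p. z i \<noteq> 0) \<and>
     (\<forall>c. \<forall>j<p. V.le (\<iota> (c j) * z j) (\<Sum>i<p. \<iota> (c i) * z i))"

text \<open>Nonzero terms with different exponents never have equal value, so the largest term
  dominates the sum.\<close>

lemma valuation_basis_ramified:
  assumes z: "ramified_elem z"
  shows "valuation_basis (\<lambda>i. z ^ i)"
proof -
  have "V.le (\<iota> (c j) * z ^ j) (\<Sum>i<p. \<iota> (c i) * z ^ i)" if j: "j < p" for c j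
  proof -
    define t where "t i = \<iota> (c i) * z ^ i" for i
    obtain m where m: "m < p" "\<And>i. i < p \<Longrightarrow> V.le (t i) (t m)"
      using V.exists_max[of "{..<p}" t] K.p_pos by auto
    have "V.lt (t i) (t m)" if "i \<in> {..<p}" "i \<noteq> m" "t m \<noteq> 0" for i
    proof (rule V.lt_if_not_sim)
      show "V.le (t i) (t m)"
        using m that by simp
      show "\<not> V.sim (t i) (t m)"
      proof
        assume sim: "V.sim (t i) (t m)"
        then have "t i \<noteq> 0"
          using that by auto
        then have "c i \<noteq> 0" "c m \<noteq> 0"
          using that by (auto simp: t_def)
        then show False
          using ramified_elem_powers[OF z, of i m "c i" "c m"] ramified_elem_powers[OF z, of m i "c m" "c i"]
            sim V.sim_sym[OF sim] m that by (auto simp: t_def neq_iff)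
      qed
    qed
    then have "V.le (t m) (\<Sum>i<p. t i)"
      using m by (cases "t m = 0") (auto intro!: V.dominant_sum)
    then show ?thesis
      using m(2)[OF j] V.le_trans unfolding t_def by blast
  qed
  then show ?thesis
    using ramified_elem_nonzero[OF z] by (simp add: valuation_basis_def)
qed

text \<open>The residue of \<open>y\<close>, for \<open>y\<close> in \<open>V\<close>, satisfies no
  nontrivial relation of degree below \<open>p\<close> over the residue field of \<open>K\<close>;
  the quotient fields are avoided by testing coefficients for being small.\<close>

definition res_independent :: "'l \<Rightarrow> bool" where
  "res_independent y \<longleftrightarrow> (\<forall>Q. (\<forall>i. coeff Q i \<in> A) \<and> degree Q < p \<and> V.lt (poly (lift Q) y) 1
     \<longrightarrow> (\<forall>i. A.lt (coeff Q i) 1))"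

lemma res_independent_sum:
  assumes "res_independent y" "\<And>i. i < p \<Longrightarrow> a i \<in> A" "V.lt (\<Sum>i<p. \<iota> (a i) * y ^ i) 1" "j < p"
  shows "A.lt (a j) 1"
proof -
  define Q where "Q = (\<Sum>i<p. monom (a i) i)"
  have coeff_Q: "coeff Q i = (if i < p then a i else 0)" for i
    by (simp add: Q_def coeff_sum)
  have "degree Q < p"
    using K.p_pos by (intro degree_lessI) (auto simp: coeff_Q)
  moreover have "coeff Q i \<in> A" for i
    using assms by (simp add: coeff_Q)
  moreover have "poly (lift Q) y = (\<Sum>i<p. \<iota> (a i) * y ^ i)"
  proof -
    have "lift Q = (\<Sum>i<p. monom (\<iota> (a i)) i)"
      by (intro poly_eqI) (simp add: coeff_Q coeff_sum)
    then show ?thesis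
      by (simp add: poly_sum poly_monom)
  qed
  ultimately have "A.lt (coeff Q j) 1"
    using assms unfolding res_independent_def by simp
  then show ?thesis
    using assms by (simp add: coeff_Q)
qed

text \<open>After division by the largest coefficient one coefficient is 1, so the sum cannot be
  small.\<close>

lemma res_independent_le_sum:
  assumes "res_independent y" "y \<in> V" "j < p"
  shows "V.le (\<iota> (c j)) (\<Sum>i<p. \<iota> (c i) * y ^ i)"
proof -
  obtain m where m: "m < p" "\<And>i. i < p \<Longrightarrow> A.le (c i) (c m)"
    using A.exists_max[of "{..<p}" c] K.p_pos by auto
  have "V.le (\<iota> (c m)) (\<Sum>i<p. \<iota> (c i) * y ^ i)"
  proof (cases "c m = 0")
    case False
    have "\<not> V.lt (\<Sum>i<p. \<iota> (c i / c m) * y ^ i) 1"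
    proof
      assume lt: "V.lt (\<Sum>i<p. \<iota> (c i / c m) * y ^ i) 1"
      have "c i / c m \<in> A" if "i < p" for i
        using m(2)[OF that] False by (simp add: A.le_def val_ge_def)
      then have "A.lt (c m / c m) 1"
        using res_independent_sum[OF assms(1) _ lt m(1)] by blast
      then show False
        using False by simp
    qed
    then have "V.le 1 (\<Sum>i<p. \<iota> (c i / c m) * y ^ i)"
      by (simp add: V.lt_def)
    also have "(\<Sum>i<p. \<iota> (c i / c m) * y ^ i) = (\<Sum>i<p. \<iota> (c i) * y ^ i) / \<iota> (c m)"
      by (simp add: sum_divide_distrib emb_divide)
    finally have "V.le (1 * \<iota> (c m)) ((\<Sum>i<p. \<iota> (c i) * y ^ i) / \<iota> (c m) * \<iota> (c m))"
      using False by (subst V.le_mult_right_iff) auto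
    then show ?thesis
      using False by simp
  qed auto
  then show ?thesis
    using m(2)[OF assms(3)] V.le_trans emb_le_iff by blast
qed

lemma valuation_basis_res_independent:
  assumes y: "res_independent y" "y \<in> V"
  shows "valuation_basis (\<lambda>i. y ^ i)"
proof -
  have "y \<noteq> 0"
  proof
    assume "y = 0"
    then have "(\<Sum>i<p. \<iota> (if i = 1 then 1 else 0) * y ^ i) = 0"
      by (intro sum.neutral) auto
    then have "A.lt (if 1 = (1::nat) then 1 else 0) 1"
      using K.p_gt_1 by (intro res_independent_sum[OF y(1), of "\<lambda>i. if i = 1 then 1 else 0" 1]) auto
    then show False
      by simp
  qed
  moreover have "V.le (\<iota> (c j) * y ^ j) (\<Sum>i<p. \<iota> (c i) * y ^ i)" if "j < p" for c j
  proof -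
    have "V.le (\<iota> (c j) * y ^ j) (\<iota> (c j) * 1)"
      using y V.power_mem by (intro V.le_mult) (auto simp: V.le_one_iff)
    then show ?thesis
      using res_independent_le_sum[OF y that] V.le_trans by simp
  qed
  ultimately show ?thesis
    by (simp add: valuation_basis_def)
qed

lemma s_cong_mult:
  assumes "V.lt (s e y - y) 1"
  shows "V.lt (s (k * e) y - y) 1"
proof (induction k)
  case (Suc k)
  have "V.lt (s e (s (k * e) y - y)) 1"
    using Suc by simp
  then have "V.lt (s e (s (k * e) y - y) + (s e y - y)) 1"
    using assms by (rule V.lt_add)
  then show ?case
    by (simp add: s.emb_diff s_add)
qed auto

text \<open>A polynomial over \<open>A\<close> that is small at \<open>y\<close> is small at all
  conjugates. If \<sigma> moves the residue of \<open>y\<close>, every nontrivial power of \<sigma>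
  does too, so the conjugates have \<open>p\<close> distinct residues, too many for degree below
  \<open>p\<close>.\<close>

lemma res_independent_separable:
  assumes "y \<in> V" "V.le 1 (\<sigma> y - y)"
  shows "res_independent y"
  unfolding res_independent_def
proof (intro allI impI, elim conjE)
  fix Q k assume Q: "\<forall>i. coeff Q i \<in> A" "degree Q < p" "V.lt (poly (lift Q) y) 1"
  have distinct: "V.le 1 (s i y - s j y)" if "i < j" "j < p" for i j
  proof (rule ccontr)
    assume "\<not> ?thesis"
    then have "V.lt (s i (y - s (j - i) y)) 1"
      using that by (simp add: V.lt_def s.emb_diff s_add)
    then have "V.lt (- (s (j - i) y - y)) 1"
      by simp
    then have "V.lt (s (j - i) y - y) 1"
      by (simp only: V.lt_uminus_iff)
    moreover have "0 < j - i" "j - i < p"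
      using that by auto
    moreover obtain k where "(k * (j - i)) mod p = 1"
      using exists_mult_eq_one_mod calculation(2,3) by blast
    ultimately have "V.lt (\<sigma> y - y) 1"
      using s_cong_mult[of "j - i" y k] s_mod[of "k * (j - i)" y] by simp
    then show False
      using assms by (simp add: V.lt_def)
  qed
  have "V.lt (coeff (lift Q) k) 1"
  proof (rule V.coeffs_lt_one_if_many_roots[where n = p and x = "\<lambda>i. s i y"])
    show "V.lt (poly (lift Q) (s i y)) 1" for i
    proof -
      have "poly (lift Q) (s i y) = s i (poly (lift Q) y)"
        by (simp add: poly_altdef s.emb_simps)
      then show ?thesis
        using Q by simp
    qed
  qed (use Q assms distinct in auto)
  then show "A.lt (coeff Q k) 1"
    by simp
qed

text \<open>The inverse of \<open>n\<close> in the prime field is again the image of a natural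
  number, hence lies in \<open>A\<close>.\<close>

lemma one_le_of_nat:
  assumes "0 < n" "n < p"
  shows "A.le 1 (of_nat n)"
proof -
  obtain k where k: "(k * n) mod p = 1"
    using exists_mult_eq_one_mod assms by blast
  then have "k * n = p * ((k * n) div p) + 1"
    by (metis mult_div_mod_eq)
  then have "of_nat (k * n) = (of_nat (p * ((k * n) div p) + 1) :: 'k)"
    by simp
  then have "of_nat k * of_nat n = (1::'k)"
    by simp
  moreover have "A.le (of_nat k * of_nat n) (1 * of_nat n)"
    by (intro A.le_mult) (auto simp: A.le_one_iff A.of_nat_mem)
  ultimately show ?thesis
    by simp
qed

text \<open>Division by a monic polynomial stays over \<open>A\<close>, and the remainder has small
  coefficients by minimality of \<open>M\<close>. The degree bound on the quotient is recorded for
  the count of vanishing orders in the inseparable case.\<close>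

lemma exists_quotient_mod_max_ideal:
  assumes M: "\<And>i. coeff M i \<in> A" "lead_coeff M = 1" "V.lt (poly (lift M) y) 1" "0 < degree M"
    and minimal: "\<And>Q. (\<And>i. coeff Q i \<in> A) \<Longrightarrow> degree Q < degree M \<Longrightarrow> V.lt (poly (lift Q) y) 1
      \<Longrightarrow> \<forall>i. A.lt (coeff Q i) 1"
    and y: "y \<in> V"
    and Q: "\<And>i. coeff Q i \<in> A" "V.lt (poly (lift Q) y) 1"
  shows "\<exists>S. (\<forall>i. coeff S i \<in> A) \<and> degree S \<le> degree Q - degree M
    \<and> (\<forall>i. A.lt (coeff (Q - M * S) i) 1)"
  using Q
proof (induction "degree Q" arbitrary: Q rule: less_induct)
  case less
  show ?case
  proof (cases "degree Q < degree M")
    case True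
    then have "\<forall>i. A.lt (coeff Q i) 1"
      using minimal less.prems by blast
    then show ?thesis
      by (intro exI[of _ 0]) simp
  next
    case False
    define T where "T = monom (lead_coeff Q) (degree Q - degree M)"
    define Q1 where "Q1 = Q - M * T"
    have T: "coeff T i \<in> A" for i
      using less.prems by (simp add: T_def)
    have MT: "coeff (M * T) i \<in> A" for i
      using M T by (intro A.coeff_mult_mem)
    have "degree Q1 < degree Q"
    proof (rule degree_lessI)
      show "Q1 \<noteq> 0 \<or> 0 < degree Q"
        using False M by simp
      show "\<forall>k\<ge>degree Q. coeff Q1 k = 0"
      proof safe
        fix k assume k: "degree Q \<le> k"
        have "degree (M * T) \<le> degree M + (degree Q - degree M)"
          using degree_mult_le[of M T] degree_monom_le[of "lead_coeff Q" "degree Q - degree M"]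
          unfolding T_def by linarith
        then have deg: "degree (M * T) \<le> degree Q"
          using False by simp
        have "coeff (M * T) (degree M + (degree Q - degree M)) = lead_coeff Q"
          using M(2) by (simp add: T_def mult.commute[of M] coeff_monom_mult)
        then have "coeff (M * T) (degree Q) = lead_coeff Q"
          using False by simp
        then show "coeff Q1 k = 0"
          using k deg by (cases "k = degree Q") (auto simp: Q1_def coeff_eq_0)
      qed
    qed
    moreover have "coeff Q1 i \<in> A" for i
      using less.prems MT by (auto simp: Q1_def intro: A.diff_mem)
    moreover have "V.lt (poly (lift Q1) y) 1"
    proof -
      have "poly (lift T) y \<in> V"
        using T y by (intro V.poly_mem) auto
      then have "V.lt (poly (lift M) y * poly (lift T) y) 1"
        using M by (intro V.lt_one_mult)
      then show ?thesis
        using less.prems by (simp add: Q1_def lift_simps V.lt_diff)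
    qed
    ultimately obtain S where S: "\<forall>i. coeff S i \<in> A" "degree S \<le> degree Q1 - degree M"
      "\<forall>i. A.lt (coeff (Q1 - M * S) i) 1"
      using less.hyps by blast
    have "degree (S + T) \<le> degree Q - degree M"
      using S(2) \<open>degree Q1 < degree Q\<close> unfolding T_def
      by (intro degree_add_le order.trans[OF degree_monom_le]) auto
    moreover have "Q - M * (S + T) = Q1 - M * S"
      by (simp add: Q1_def algebra_simps)
    ultimately show ?thesis
      using S T by (intro exI[of _ "S + T"]) (auto intro: A.add_mem)
  qed
qed

lemma coeff_shift_0: "coeff (pcompose P [:y, 1:]) 0 = poly P y"
  by (simp add: poly_0_coeff_0[symmetric] poly_pcompose)

lemma coeff_shift_1: "coeff (pcompose P [:y, 1:]) (Suc 0) = poly (pderiv P) (y :: 'l)"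
proof -
  have "coeff (pderiv (pcompose P [:y, 1:])) 0 = poly (pderiv P) y"
    by (simp add: pderiv_pcompose pderiv_pCons coeff_shift_0)
  then show ?thesis
    by (simp add: coeff_pderiv)
qed

text \<open>If \<open>M\<close> is the minimal polynomial of the residue of \<open>y\<close>, then \<open>M'(y)\<close> is a unit because
  \<open>degree M < p\<close>, so \<open>y\<close> is a simple root of \<open>M\<close>.  Writing \<open>T ^ p - u \<equiv> (T - y) ^ p\<close> as \<open>M * S\<close>, the
  cofactor \<open>S\<close> vanishes to order \<open>p - 1\<close> at \<open>y\<close>, which forces \<open>degree M = 1\<close>.\<close>

lemma res_independent_inseparable:
  assumes y: "y \<in> V" "V.lt (y ^ p - \<iota> u) 1" and u: "u \<in> A"
    and y_notin: "\<And>a. a \<in> A \<Longrightarrow> V.le 1 (y - \<iota> a)"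
  shows "res_independent y"
proof (rule ccontr)
  define bad where "bad Q \<longleftrightarrow> (\<forall>i. coeff Q i \<in> A) \<and> V.lt (poly (lift Q) y) 1 \<and> (\<exists>i. A.le 1 (coeff Q i))" for Q
  assume "\<not> res_independent y"
  then obtain Q0 where Q0: "bad Q0" "degree Q0 < p"
    unfolding res_independent_def bad_def A.lt_def by blast
  define n where "n = (LEAST n. \<exists>Q. bad Q \<and> degree Q = n)"
  have "\<exists>Q. bad Q \<and> degree Q = n"
    unfolding n_def by (rule LeastI[of _ "degree Q0"]) (use Q0 in blast)
  then obtain M0 where M0: "bad M0" "degree M0 = n"
    by blast
  have "n \<le> degree Q0"
    unfolding n_def by (rule Least_le) (use Q0 in blast)
  then have "n < p"
    using Q0 by simp
  have not_bad: "\<not> bad Q" if "degree Q < n" for Q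
    using not_less_Least[of "degree Q" "\<lambda>n. \<exists>Q. bad Q \<and> degree Q = n"] that unfolding n_def by blast
  then have minimal: "\<forall>i. A.lt (coeff Q i) 1"
    if "\<And>i. coeff Q i \<in> A" "degree Q < n" "V.lt (poly (lift Q) y) 1" for Q
    using that unfolding bad_def A.lt_def by blast
  have "n \<noteq> 0"
  proof
    assume "n = 0"
    then obtain c where "M0 = [:c:]"
      using M0 degree_eq_zeroE by metis
    then show False
      using M0 by (auto simp: bad_def lift_simps A.lt_def coeff_pCons split: nat.splits)
  qed
  define c where "c = lead_coeff M0"
  have "c \<in> A"
    using M0 by (simp add: bad_def c_def)
  \<comment> \<open>A small leading term could be dropped without losing the relation, contradicting
    minimality of the degree.\<close>
  have c: "A.le 1 c"
  proof (rule ccontr)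
    assume "\<not> A.le 1 c"
    then have c_lt: "A.lt c 1"
      by (simp add: A.lt_def)
    define Q where "Q = M0 - monom c n"
    have "degree Q < n"
      using \<open>n \<noteq> 0\<close> M0 by (intro degree_lessI) (auto simp: Q_def c_def coeff_eq_0)
    moreover have "coeff Q i \<in> A" for i
      using M0 \<open>c \<in> A\<close> by (auto simp: Q_def bad_def intro: A.diff_mem)
    moreover have "V.lt (poly (lift Q) y) 1"
    proof -
      have "V.lt (\<iota> c * y ^ n) 1"
        using c_lt y by (intro V.lt_one_mult V.power_mem) auto
      then show ?thesis
        using M0 by (simp add: Q_def lift_simps poly_monom bad_def V.lt_diff)
    qed
    ultimately have "A.lt (coeff Q i) 1" for i
      using minimal by blast
    moreover have "coeff M0 i = coeff Q i + (if i = n then c else 0)" for i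
      by (simp add: Q_def)
    ultimately have "A.lt (coeff M0 i) 1" for i
      using c_lt by (auto intro: A.lt_add)
    then show False
      using M0 by (auto simp: bad_def A.lt_def)
  qed
  have "c \<noteq> 0"
    using c by auto
  then have c_inv: "inverse c \<in> A"
    using c by (simp add: A.le_def val_ge_def inverse_eq_divide)
  define M where "M = smult (inverse c) M0"
  have M: "coeff M i \<in> A" "lead_coeff M = 1" "degree M = n" for i
    using M0 c_inv \<open>c \<noteq> 0\<close> by (auto simp: M_def c_def bad_def intro: A.mult_mem)
  have M_y: "V.lt (poly (lift M) y) 1"
    using M0 c_inv by (auto simp: M_def lift_simps bad_def intro: V.lt_one_mult')
  \<comment> \<open>A monic linear relation would make \<open>y\<close> congruent to an element of
    \<open>A\<close>.\<close>
  have "n \<noteq> 1"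
  proof
    assume "n = 1"
    then have "M = [:coeff M 0, 1:]"
      using M by (intro poly_eqI) (auto simp: coeff_pCons coeff_eq_0 split: nat.split)
    then have "poly (lift M) y = y - \<iota> (- coeff M 0)"
      by (metis (no_types, opaque_lifting) emb_one emb_uminus emb_zero diff_minus_eq_add add.commute
          lift_pCons map_poly_0 mult.right_neutral mult_zero_right poly_0 poly_pCons add.right_neutral)
    then show False
      using M_y y_notin[of "- coeff M 0"] M(1) by (simp add: V.lt_def A.uminus_mem)
  qed
  \<comment> \<open>The derivative has smaller degree, and its leading coefficient \<open>n\<close>
    is a unit because \<open>0 < n < p\<close>; minimality then prevents it from being small at
    \<open>y\<close>.\<close>
  have M'_y: "V.le 1 (poly (lift (pderiv M)) y)"
  proof (rule ccontr)
    assume "\<not> ?thesis"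
    moreover have "coeff (pderiv M) i \<in> A" for i
      unfolding coeff_pderiv using M by (intro A.mult_mem A.of_nat_mem)
    moreover have "degree (pderiv M) < n"
      using M(3) \<open>n \<noteq> 0\<close> by (intro degree_lessI) (auto simp: coeff_pderiv coeff_eq_0)
    ultimately have "A.lt (coeff (pderiv M) (n - 1)) 1"
      using minimal by (simp add: V.lt_def)
    then have "A.lt (of_nat n) 1"
      using M(2,3) \<open>n \<noteq> 0\<close> by (simp add: coeff_pderiv del: of_nat_Suc)
    then show False
      using one_le_of_nat[of n] \<open>n \<noteq> 0\<close> \<open>n < p\<close> by (simp add: A.lt_def)
  qed
  define Q where "Q = monom 1 p - [:u:]"
  have coeff_Q: "coeff Q i = (if i = p then 1 else 0) - (if i = 0 then u else 0)" for i
    by (simp add: Q_def coeff_pCons split: nat.split)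
  have "degree Q \<le> p"
    by (intro degree_le) (auto simp: coeff_Q K.p_pos)
  have "\<exists>S. (\<forall>i. coeff S i \<in> A) \<and> degree S \<le> degree Q - degree M
    \<and> (\<forall>i. A.lt (coeff (Q - M * S) i) 1)"
  proof (rule exists_quotient_mod_max_ideal[OF M(1,2) M_y])
    show "coeff Q i \<in> A" for i
      using u by (auto simp: coeff_Q intro!: A.diff_mem A.uminus_mem)
    show "V.lt (poly (lift Q) y) 1"
      using y by (simp add: Q_def lift_simps poly_monom)
  qed (use \<open>n \<noteq> 0\<close> M y minimal in auto)
  then obtain S where S: "\<And>i. coeff S i \<in> A" "degree S \<le> p - n" "\<And>i. A.lt (coeff (Q - M * S) i) 1"
    using \<open>degree Q \<le> p\<close> M(3) by (metis diff_le_mono order.trans)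
  \<comment> \<open>Taylor expansions at \<open>y\<close>: vanishing of the reductions at
    \<open>y\<close> is read off from the low coefficients.\<close>
  define m s q where "m = pcompose (lift M) [:y, 1:]" and "s = pcompose (lift S) [:y, 1:]"
    and "q = pcompose (lift Q) [:y, 1:]"
  have m: "coeff m i \<in> V" and s: "coeff s i \<in> V" for i
    unfolding m_def s_def using M S y by (auto intro!: V.coeff_pcompose_linear_mem)
  have qms: "V.lt (coeff (q - m * s) i) 1" for i
  proof -
    have "q - m * s = pcompose (lift (Q - M * S)) [:y, 1:]"
      by (simp add: q_def m_def s_def lift_simps pcompose_diff pcompose_mult)
    then show ?thesis
      using S(3) y V.coeff_pcompose_linear_lt_one[of "lift (Q - M * S)"] by simp
  qed
  \<comment> \<open>By Frobenius no intermediate powers occur, so all coefficients of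
    \<open>q\<close> below index \<open>p\<close> are small.\<close>
  have q: "q = monom 1 p + [:y ^ p - \<iota> u:]"
  proof -
    have "pcompose (monom 1 k) r = r ^ k" for k and r :: "'l poly"
      by (induction k) (simp_all add: monom_Suc pcompose_pCons pcompose_1)
    then have "q = [:y, 1:] ^ p - [:\<iota> u:]"
      by (simp add: q_def Q_def lift_simps pcompose_diff)
    also have "[:y, 1:] = monom 1 1 + [:y:]"
      by (simp add: monom_Suc)
    also have "\<dots> ^ p = monom 1 1 ^ p + [:y:] ^ p"
      by (rule freshmans_dream) (simp_all add: L.prime L.char)
    finally show ?thesis
      by (simp add: monom_power poly_const_pow)
  qed
  have "\<exists>j. V.le 1 (coeff s j)"
  proof (rule ccontr)
    assume "\<not> ?thesis"
    then have "V.lt (coeff (m * s) p) 1"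
      unfolding coeff_mult using m by (intro V.lt_sum V.lt_one_mult') (auto simp: V.lt_def)
    then have "V.lt (coeff (q - m * s) p + coeff (m * s) p) 1"
      using qms by (intro V.lt_add)
    then show False
      using K.p_pos by (simp add: q coeff_pCons split: nat.splits)
  qed
  \<comment> \<open>The vanishing order of the reduction of \<open>s\<close>. As
    \<open>coeff m 0\<close> is small and \<open>coeff m 1\<close> is a unit, the product
    \<open>m * s\<close> has a unit coefficient at index \<open>j + 1\<close>.\<close>
  define j where "j = (LEAST j. V.le 1 (coeff s j))"
  have j: "V.le 1 (coeff s j)"
    unfolding j_def by (rule LeastI_ex) fact
  have j_less: "V.lt (coeff s i) 1" if "i < j" for i
    using not_less_Least that unfolding j_def V.lt_def by blast
  have "j \<le> degree s"
    using j by (intro le_degree) auto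
  also have "\<dots> = degree S"
    by (simp add: s_def degree_pcompose)
  \<comment> \<open>Here \<open>n \<ge> 2\<close> enters: \<open>j\<close> is at most
    \<open>p - n\<close>, so \<open>j + 1\<close> stays below the index \<open>p\<close> of the only
    unit coefficient of \<open>q\<close>.\<close>
  finally have "Suc j < p"
    using S(2) \<open>n \<noteq> 0\<close> \<open>n \<noteq> 1\<close> \<open>n < p\<close> by linarith
  have "coeff (m * s) (Suc j) = (\<Sum>i\<in>{..Suc j} - {Suc 0}. coeff m i * coeff s (Suc j - i))
      + coeff m (Suc 0) * coeff s j"
    unfolding coeff_mult by (subst sum.remove[of _ "Suc 0"]) auto
  moreover have "V.lt (\<Sum>i\<in>{..Suc j} - {Suc 0}. coeff m i * coeff s (Suc j - i)) 1"
  proof (intro V.lt_sum)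
    fix i assume i: "i \<in> {..Suc j} - {Suc 0}"
    show "V.lt (coeff m i * coeff s (Suc j - i)) 1"
    proof (cases "i = 0")
      case True
      have "V.lt (coeff m 0) 1"
        using M_y by (simp only: m_def coeff_shift_0)
      then show ?thesis
        using True s by (auto intro: V.lt_one_mult)
    next
      case False
      then show ?thesis
        using i m by (intro V.lt_one_mult' j_less) auto
    qed
  qed auto
  moreover have "V.le 1 (coeff m (Suc 0) * coeff s j)"
    using M'_y j unfolding m_def coeff_shift_1 lift_pderiv[symmetric] by (rule V.one_le_mult)
  ultimately have "V.le 1 (coeff (m * s) (Suc j))"
    by (simp add: V.one_le_lt_add)
  moreover have "coeff (m * s) (Suc j) = - coeff (q - m * s) (Suc j)"
    using \<open>Suc j < p\<close> by (simp add: q coeff_pCons)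
  ultimately have "V.le 1 (- coeff (q - m * s) (Suc j))"
    by (simp only:)
  then show False
    using qms[of "Suc j"] unfolding V.uminus_le_iff V.lt_def by blast
qed

definition inertial_elem :: "'l \<Rightarrow> bool" where
  "inertial_elem y \<longleftrightarrow> y \<in> V \<and> (\<forall>a\<in>A. V.le 1 (y - \<iota> a))"

text \<open>Either \<sigma> moves some residue, or it fixes all of them. In the latter case every
  conjugate of \<open>y\<close> is congruent to \<open>y\<close>, so the norm of \<open>y\<close> is
  congruent to \<open>y ^ p\<close>, whose residue therefore comes from \<open>K\<close>.\<close>

lemma exists_res_independent:
  assumes y: "inertial_elem y"
  shows "\<exists>z\<in>V. res_independent z"
proof (cases "\<exists>z\<in>V. V.le 1 (\<sigma> z - z)")
  case True
  then show ?thesis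
    using res_independent_separable by blast
next
  case False
  have "y \<in> V"
    using y by (simp add: inertial_elem_def)
  obtain u where u: "(\<Prod>i<p. s i y) = \<iota> u"
    using prod_conjugates_in_range by blast
  have "V.lt (s i y - y) 1" for i
    using s_cong_mult[of 1 y i] False \<open>y \<in> V\<close> by (simp add: V.lt_def)
  then have "V.lt ((\<Prod>i<p. s i y) - y ^ p) 1"
    using \<open>y \<in> V\<close> by (intro V.prod_cong_power) auto
  then have "V.lt (- (y ^ p - \<iota> u)) 1"
    by (simp add: u)
  then have "V.lt (y ^ p - \<iota> u) 1"
    by (simp only: V.lt_uminus_iff)
  moreover have "(\<Prod>i<p. s i y) \<in> V"
    using \<open>y \<in> V\<close> by (intro V.prod_mem) simp
  then have "u \<in> A"
    by (simp add: u)
  ultimately show ?thesis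
    using res_independent_inseparable[of y u] y unfolding inertial_elem_def by blast
qed

end

section \<open>Ramification index and residue degree\<close>

context vector_space
begin

lemma independent_family:
  fixes z :: "nat \<Rightarrow> 'b"
  assumes "\<And>c. (\<Sum>i<n. c i *s z i) = 0 \<Longrightarrow> \<forall>i<n. c i = 0"
  shows "inj_on z {..<n}" "independent (z ` {..<n})"
proof -
  show inj: "inj_on z {..<n}"
  proof (rule inj_onI, rule ccontr)
    fix i j assume ij: "i \<in> {..<n}" "j \<in> {..<n}" "z i = z j" "i \<noteq> j"
    define c where "c k = (if k = i then 1 else if k = j then - 1 else 0 :: 'a)" for k
    have "(\<Sum>k<n. c k *s z k) = (\<Sum>k\<in>{i, j}. c k *s z k)"
      using ij by (intro sum.mono_neutral_right) (auto simp: c_def)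
    also have "\<dots> = 0"
      using ij by (simp add: c_def)
    finally have "c i = 0"
      using assms ij by auto
    then show False
      by (simp add: c_def)
  qed
  show "independent (z ` {..<n})"
    unfolding dependent_finite[OF finite_imageI[OF finite_lessThan]]
  proof clarify
    fix u v i assume "(\<Sum>v\<in>z ` {..<n}. u v *s v) = 0" and i: "i < n" "u (z i) \<noteq> 0"
    then have "(\<Sum>i<n. u (z i) *s z i) = 0"
      using inj by (simp add: sum.reindex)
    then show False
      using assms[of "\<lambda>i. u (z i)"] i by auto
  qed
qed

lemma span_family:
  fixes z :: "nat \<Rightarrow> 'b"
  assumes "x \<in> span (z ` {..<n})" "inj_on z {..<n}"
  shows "\<exists>c. x = (\<Sum>i<n. c i *s z i)"
proof -
  obtain u where "x = (\<Sum>v\<in>z ` {..<n}. u v *s v)"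
    using assms(1) by (auto simp: span_finite)
  then have "x = (\<Sum>i<n. u (z i) *s z i)"
    using assms(2) by (simp add: sum.reindex)
  then show ?thesis
    by (rule exI[of _ "\<lambda>i. u (z i)"])
qed

end

lemma card_quotient_family:
  assumes "equiv S r" "\<And>i. i < n \<Longrightarrow> z i \<in> S" "\<And>x. x \<in> S \<Longrightarrow> \<exists>i<n. (x, z i) \<in> r"
    "\<And>i j. i < j \<Longrightarrow> j < n \<Longrightarrow> (z i, z j) \<notin> r"
  shows "card (S // r) = n"
proof -
  have "inj_on (\<lambda>i. r `` {z i}) {..<n}"
  proof (rule linorder_inj_onI)
    fix i j assume "i < j" "i \<in> {..<n}" "j \<in> {..<n}"
    then show "r `` {z i} \<noteq> r `` {z j}"
      using assms(4)[of i j] eq_equiv_class[OF _ assms(1) assms(2)] by auto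
  qed auto
  moreover have "(\<lambda>i. r `` {z i}) ` {..<n} = S // r"
  proof
    show "(\<lambda>i. r `` {z i}) ` {..<n} \<subseteq> S // r"
      using assms(2) by (auto intro: quotientI)
    show "S // r \<subseteq> (\<lambda>i. r `` {z i}) ` {..<n}"
    proof
      fix X assume "X \<in> S // r"
      then obtain x where x: "x \<in> S" "X = r `` {x}"
        by (auto elim: quotientE)
      then obtain i where "i < n" "(x, z i) \<in> r"
        using assms(3) by blast
      then show "X \<in> (\<lambda>i. r `` {z i}) ` {..<n}"
        using x equiv_class_eq[OF assms(1)] by auto
    qed
  qed
  ultimately show ?thesis
    by (metis card_image card_lessThan)
qed

context AS_ext
begin

sublocale vs: vector_space "\<lambda>c x. \<iota> c * x"
  by unfold_locales (simp_all add: emb_simps algebra_simps)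

lemma gen_powers_independent:
  assumes "(\<Sum>i<p. \<iota> (c i) * \<alpha> ^ i) = 0"
  shows "\<forall>i<p. c i = 0"
proof -
  define Q where "Q = (\<Sum>i<p. monom (c i) i)"
  have coeff_Q: "coeff Q i = (if i < p then c i else 0)" for i
    by (simp add: Q_def coeff_sum)
  have "lift Q = (\<Sum>i<p. monom (\<iota> (c i)) i)"
    by (intro poly_eqI) (simp add: coeff_Q coeff_sum)
  then have "poly (lift Q) \<alpha> = 0"
    using assms by (simp add: poly_sum poly_monom)
  moreover have "degree Q < p"
    using K.p_pos by (intro degree_lessI) (auto simp: coeff_Q)
  ultimately have "Q = 0"
    using poly_gen_nonzero by blast
  then show ?thesis
    using coeff_Q by (metis coeff_0)
qed

lemma gen_powers_span: "vs.span ((\<lambda>i. \<alpha> ^ i) ` {..<p}) = UNIV"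
proof -
  have "x \<in> vs.span ((\<lambda>i. \<alpha> ^ i) ` {..<p})" for x
  proof -
    obtain Q0 where "poly (lift Q0) \<alpha> = x"
      using exists_poly_gen by blast
    then obtain Q where Q: "degree Q < p" "poly (lift Q) \<alpha> = x"
      using poly_gen_reduce[of Q0] by blast
    have "(\<Sum>i\<le>degree Q. \<iota> (coeff Q i) * \<alpha> ^ i) \<in> vs.span ((\<lambda>i. \<alpha> ^ i) ` {..<p})"
      using Q(1) by (intro vs.span_sum vs.span_scale vs.span_base) auto
    then show ?thesis
      using Q(2) by (simp add: poly_altdef)
  qed
  then show ?thesis by blast
qed

sublocale vs: finite_dimensional_vector_space "\<lambda>c x. \<iota> c * x" "(\<lambda>i. \<alpha> ^ i) ` {..<p}"
  using vs.independent_family(2)[of "\<lambda>i. \<alpha> ^ i" p] gen_powers_independent gen_powers_span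
  by unfold_locales auto

lemma ext_degree_eq: "ext_degree \<iota> = p"
proof -
  have "vs.dim UNIV = card ((\<lambda>i. \<alpha> ^ i) ` {..<p})"
    by (rule vs.dim_UNIV)
  also have "\<dots> = p"
    using vs.independent_family(1)[of "\<lambda>i. \<alpha> ^ i" p] gen_powers_independent by (simp add: card_image)
  finally show ?thesis
    by (simp add: ext_degree_def)
qed

lemma independent_family_spans:
  assumes "\<And>c. (\<Sum>i<p. \<iota> (c i) * z i) = 0 \<Longrightarrow> \<forall>i<p. c i = 0"
  shows "\<exists>c. x = (\<Sum>i<p. \<iota> (c i) * z i)"
proof -
  have z: "inj_on z {..<p}" "vs.independent (z ` {..<p})"
    using vs.independent_family[of z p] assms by auto
  have "UNIV \<subseteq> vs.span (z ` {..<p})"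
    using z ext_degree_eq by (intro vs.card_ge_dim_independent) (auto simp: card_image ext_degree_def)
  then show ?thesis
    using vs.span_family z(1) by blast
qed

lemma exists_linear_relation:
  assumes "\<And>j. j < m \<Longrightarrow> w j \<in> vs.span T" "finite T" "card T < m"
  shows "\<exists>c. (\<Sum>j<m. \<iota> (c j) * w j) = 0 \<and> (\<exists>j<m. c j \<noteq> 0)"
proof (rule ccontr)
  assume "\<not> ?thesis"
  then have w: "inj_on w {..<m}" "vs.independent (w ` {..<m})"
    using vs.independent_family[of w m] by blast+
  have "card (w ` {..<m}) \<le> card T"
    using vs.independent_span_bound[OF assms(2) w(2)] assms(1) by auto
  then show False
    using w(1) assms(3) by (simp add: card_image)
qed

end

context AS_val
begin

text \<open>A vanishing sum bounds each of its terms by 0, so the \<open>p\<close> elements are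
  independent in a space of dimension \<open>p\<close>.\<close>

lemma valuation_basis_expand:
  assumes z: "valuation_basis z"
  shows "\<exists>c. x = (\<Sum>i<p. \<iota> (c i) * z i)"
proof (rule independent_family_spans, intro allI impI)
  fix c i assume "(\<Sum>i<p. \<iota> (c i) * z i) = 0" "i < p"
  then have "V.le (\<iota> (c i) * z i) 0" "z i \<noteq> 0"
    using z unfolding valuation_basis_def by metis+
  then show "c i = 0"
    by simp
qed

lemma valuation_basis_le:
  assumes "valuation_basis z" "x = (\<Sum>i<p. \<iota> (c i) * z i)" "j < p"
  shows "V.le (\<iota> (c j) * z j) x"
  using assms unfolding valuation_basis_def by metis

lemma sum_split_zero: "(\<Sum>i<p. g i) = g 0 + (\<Sum>i\<in>{1..<p}. g i :: 'l)"
proof -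
  have "{..<p} = insert 0 {1..<p}"
    using K.p_pos by auto
  then show ?thesis by simp
qed

section \<open>Best approximation of \<alpha> by elements of \<open>K\<close>\<close>

definition best_approx :: "'k \<Rightarrow> bool" where
  "best_approx a \<longleftrightarrow> (\<forall>h. V.le (\<alpha> - \<iota> a) (\<alpha> - \<iota> h))"

text \<open>Subtracting \<open>h\<close> changes only the constant coefficient; all other terms of
  \<alpha> remain and are bounded by \<alpha> - h.\<close>

lemma exists_best_approx:
  assumes z: "valuation_basis z"
  shows "\<exists>a. best_approx a"
proof -
  obtain c where c: "\<alpha> = (\<Sum>i<p. \<iota> (c i) * z i)"
    using valuation_basis_expand[OF z] by blast
  have z0: "z 0 = 1"
    using z by (simp add: valuation_basis_def)
  have "V.le (\<alpha> - \<iota> (c 0)) (\<alpha> - \<iota> h)" for h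
  proof -
    have "\<alpha> - \<iota> h = (\<Sum>i<p. \<iota> ((c(0 := c 0 - h)) i) * z i)"
      unfolding c sum_split_zero by (simp add: z0 emb_diff)
    then have le: "V.le (\<iota> (c j) * z j) (\<alpha> - \<iota> h)" if "j \<in> {1..<p}" for j
      using valuation_basis_le[OF z, of _ "c(0 := c 0 - h)" j] that by auto
    have eq: "\<alpha> - \<iota> (c 0) = (\<Sum>i\<in>{1..<p}. \<iota> (c i) * z i)"
      using c unfolding sum_split_zero by (simp add: z0)
    show ?thesis
      unfolding eq by (intro V.le_sum le)
  qed
  then show ?thesis
    unfolding best_approx_def by blast
qed

text \<open>In the basis of powers of \<open>z\<close>, the nonconstant terms of an integral element
  are integral and never have value 0, hence are small; its residue is that of the constant
  coefficient.\<close>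

lemma ramified_imp_not_inertial:
  assumes z: "ramified_elem z"
  shows "\<not> inertial_elem x"
proof
  assume x: "inertial_elem x"
  have basis: "valuation_basis (\<lambda>i. z ^ i)"
    using z by (rule valuation_basis_ramified)
  obtain c where c: "x = (\<Sum>i<p. \<iota> (c i) * z ^ i)"
    using valuation_basis_expand[OF basis] by blast
  have le: "V.le (\<iota> (c j) * z ^ j) 1" if "j < p" for j
    using valuation_basis_le[OF basis c that] x V.le_trans V.le_one_iff unfolding inertial_elem_def by blast
  have "V.lt (\<iota> (c j) * z ^ j) 1" if j: "j \<in> {1..<p}" for j
  proof (rule V.lt_if_not_sim)
    show "V.le (\<iota> (c j) * z ^ j) 1"
      using le j by simp
    show "\<not> V.sim (\<iota> (c j) * z ^ j) 1"
    proof
      assume sim: "V.sim (\<iota> (c j) * z ^ j) 1"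
      then have sim': "V.sim (\<iota> 1 * z ^ 0) (\<iota> (c j) * z ^ j)"
        by (simp add: V.sim_sym)
      have "c j = 0"
        using ramified_elem_powers[OF z _ _ sim'] j by simp
      then show False
        using sim by simp
    qed
  qed
  then have "V.lt (\<Sum>i\<in>{1..<p}. \<iota> (c i) * z ^ i) 1"
    by (intro V.lt_sum) auto
  then have "V.lt (x - \<iota> (c 0)) 1"
    by (simp add: c sum_split_zero)
  moreover have "c 0 \<in> A"
    using le[of 0] K.p_pos by (simp add: A.le_one_iff)
  ultimately show False
    using x by (auto simp: inertial_elem_def V.lt_def)
qed

section \<open>Residue degree\<close>

lemma max_ideal_iff_lt: "x \<in> max_ideal V \<longleftrightarrow> V.lt x 1" "a \<in> max_ideal A \<longleftrightarrow> A.lt a 1"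
  by (rule V.max_ideal_iff A.max_ideal_iff)+

lemma residue_basis_iff:
  "residue_basis \<iota> A bs \<longleftrightarrow> set bs \<subseteq> V \<and>
    (\<forall>as. length as = length bs \<and> set as \<subseteq> A \<and> V.lt (\<Sum>i<length bs. \<iota> (as ! i) * bs ! i) 1
      \<longrightarrow> (\<forall>i<length bs. A.lt (as ! i) 1)) \<and>
    (\<forall>y\<in>V. \<exists>as. length as = length bs \<and> set as \<subseteq> A \<and>
      V.lt (y - (\<Sum>i<length bs. \<iota> (as ! i) * bs ! i)) 1)"
  unfolding residue_basis_def Let_def int_closure_eq max_ideal_iff_lt ..

text \<open>Gives the uniqueness required by the definite description in
  \<open>residue_degree\<close>.\<close>

lemma residue_basis_length_le:
  assumes bs: "residue_basis \<iota> A bs" and cs: "residue_basis \<iota> A cs"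
  shows "length cs \<le> length bs"
proof (rule ccontr)
  assume less: "\<not> length cs \<le> length bs"
  define n m where "n = length bs" and "m = length cs"
  have cs_V: "cs ! j \<in> V" if "j < m" for j
    using cs that unfolding residue_basis_iff m_def by (auto simp: subset_iff)
  have "\<exists>as. length as = n \<and> set as \<subseteq> A \<and> V.lt (cs ! j - (\<Sum>i<n. \<iota> (as ! i) * bs ! i)) 1" if "j < m" for j
    using bs cs_V[OF that] unfolding residue_basis_iff n_def by blast
  then obtain as where as: "\<And>j. j < m \<Longrightarrow> V.lt (cs ! j - (\<Sum>i<n. \<iota> (as j ! i) * bs ! i)) 1"
    by metis
  \<comment> \<open>Replacing each element of \<open>cs\<close> by a combination of
    \<open>bs\<close> with the same residue turns the dimension count into one over
    \<open>K\<close>. The relation found there, scaled so that its largest coefficient is 1, reduces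
    to a nontrivial relation among the residues of \<open>cs\<close>.\<close>
  define w where "w j = (\<Sum>i<n. \<iota> (as j ! i) * bs ! i)" for j
  have "w j \<in> vs.span (set bs)" for j
    unfolding w_def by (intro vs.span_sum vs.span_scale vs.span_base) (auto simp: n_def)
  moreover have "card (set bs) < m"
    using less card_length[of bs] by (simp add: m_def)
  ultimately obtain c where c: "(\<Sum>j<m. \<iota> (c j) * w j) = 0" "\<exists>j<m. c j \<noteq> 0"
    using exists_linear_relation[of m w "set bs"] by auto
  then obtain k where k: "k < m" "\<And>j. j < m \<Longrightarrow> A.le (c j) (c k)"
    using A.exists_max[of "{..<m}" c] by auto
  have "c k \<noteq> 0"
    using c(2) k(2) by auto
  define d where "d j = c j / c k" for j
  have d: "d j \<in> A" if "j < m" for j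
    using k(2)[OF that] \<open>c k \<noteq> 0\<close> by (simp add: d_def A.le_def val_ge_def)
  have "(\<Sum>j<m. \<iota> (d j) * w j) = (\<Sum>j<m. \<iota> (c j) * w j) / \<iota> (c k)"
    by (simp add: d_def emb_divide sum_divide_distrib)
  then have dw: "(\<Sum>j<m. \<iota> (d j) * w j) = 0"
    using c(1) by simp
  have "V.lt (\<Sum>j<m. \<iota> (d j) * (cs ! j - w j)) 1"
    using as d unfolding w_def by (intro V.lt_sum V.lt_one_mult') auto
  also have "(\<Sum>j<m. \<iota> (d j) * (cs ! j - w j)) = (\<Sum>j<m. \<iota> (d j) * cs ! j)"
    using dw by (simp add: right_diff_distrib sum_subtractf)
  finally have "V.lt (\<Sum>j<m. \<iota> (map d [0..<m] ! j) * cs ! j) 1"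
    by simp
  moreover have "set (map d [0..<m]) \<subseteq> A" "length (map d [0..<m]) = m"
    using d by auto
  ultimately have "A.lt (map d [0..<m] ! k) 1"
    using cs k(1) unfolding residue_basis_iff m_def by blast
  then show False
    using k(1) \<open>c k \<noteq> 0\<close> by (simp add: d_def)
qed

lemma residue_degree_eqI:
  assumes "residue_basis \<iota> A bs"
  shows "residue_degree \<iota> A = length bs"
  unfolding residue_degree_def
proof (rule the_equality)
  show "\<exists>bs'. length bs' = length bs \<and> residue_basis \<iota> A bs'"
    using assms by blast
  show "n = length bs" if "\<exists>bs'. length bs' = n \<and> residue_basis \<iota> A bs'" for n
    using that residue_basis_length_le assms by (auto intro: antisym)
qed

lemma residue_degree_if_no_inertial:
  assumes "\<And>y. \<not> inertial_elem y"
  shows "residue_degree \<iota> A = 1"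
proof -
  have "residue_basis \<iota> A [1]"
    unfolding residue_basis_iff
  proof (intro conjI ballI)
    fix y assume "y \<in> V"
    then obtain a where "a \<in> A" "V.lt (y - \<iota> a) 1"
      using assms[of y] unfolding inertial_elem_def V.lt_def by blast
    then show "\<exists>as. length as = length [1::'l] \<and> set as \<subseteq> A \<and>
        V.lt (y - (\<Sum>i<length [1::'l]. \<iota> (as ! i) * [1] ! i)) 1"
      by (intro exI[of _ "[a]"]) simp
  qed auto
  then show ?thesis
    using residue_degree_eqI by fastforce
qed

lemma residue_degree_if_res_independent:
  assumes y: "res_independent y" "y \<in> V"
  shows "residue_degree \<iota> A = p"
proof -
  define bs where "bs = map (\<lambda>i. y ^ i) [0..<p]"
  have len: "length bs = p" and nth: "i < p \<Longrightarrow> bs ! i = y ^ i" for i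
    by (simp_all add: bs_def)
  have "residue_basis \<iota> A bs"
    unfolding residue_basis_iff len
  proof (intro conjI ballI allI impI; (elim conjE)?)
    show "set bs \<subseteq> V"
      using y by (auto simp: bs_def V.power_mem)
  next
    fix as i assume as: "length as = p" "set as \<subseteq> A" "V.lt (\<Sum>i<p. \<iota> (as ! i) * bs ! i) 1" "i < p"
    have "V.lt (\<Sum>i<p. \<iota> (as ! i) * y ^ i) 1"
      using as(3) by (simp add: nth)
    moreover have "as ! i \<in> A" if "i < p" for i
      using as that by (metis nth_mem subsetD)
    ultimately show "A.lt (as ! i) 1"
      using res_independent_sum[OF y(1)] as(4) by blast
  next
    fix x assume x: "x \<in> V"
    obtain c where c: "x = (\<Sum>i<p. \<iota> (c i) * y ^ i)"
      using valuation_basis_expand[OF valuation_basis_res_independent[OF y]] by blast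
    have "c i \<in> A" if "i < p" for i
    proof -
      have "V.le (\<iota> (c i)) 1"
        using res_independent_le_sum[OF y that, of c] x V.le_trans V.le_one_iff unfolding c by blast
      then show ?thesis
        by (simp add: A.le_one_iff)
    qed
    then show "\<exists>as. length as = p \<and> set as \<subseteq> A \<and> V.lt (x - (\<Sum>i<p. \<iota> (as ! i) * bs ! i)) 1"
      by (intro exI[of _ "map c [0..<p]"]) (auto simp: c nth)
  qed
  then show ?thesis
    using residue_degree_eqI len by metis
qed

section \<open>Ramification index\<close>

definition class_rel :: "('l \<times> 'l) set" where
  "class_rel = {(x, y). x \<noteq> 0 \<and> y \<noteq> 0 \<and> (\<exists>c. c \<noteq> 0 \<and> V.sim x (\<iota> c * y))}"

lemma ram_index_eq: "ram_index \<iota> A = card ({x. x \<noteq> 0} // class_rel)"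
proof -
  have "(\<exists>c u. c \<noteq> 0 \<and> u \<in> units_of_vr V \<and> x = \<iota> c * u * y) \<longleftrightarrow> (\<exists>c. c \<noteq> 0 \<and> V.sim x (\<iota> c * y))"
    if "x \<noteq> 0" "y \<noteq> 0" for x y
  proof
    assume "\<exists>c u. c \<noteq> 0 \<and> u \<in> units_of_vr V \<and> x = \<iota> c * u * y"
    then obtain c u where cu: "c \<noteq> 0" "V.sim u 1" "x = \<iota> c * u * y"
      by (auto simp: V.units_iff V.sim_def)
    have "V.sim (u * (\<iota> c * y)) (1 * (\<iota> c * y))"
      using cu by (intro V.sim_mult) auto
    then show "\<exists>c. c \<noteq> 0 \<and> V.sim x (\<iota> c * y)"
      using cu by (auto simp: ac_simps)
  next
    assume "\<exists>c. c \<noteq> 0 \<and> V.sim x (\<iota> c * y)"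
    then obtain c where c: "c \<noteq> 0" "V.sim x (\<iota> c * y)"
      by blast
    have "V.sim (x / (\<iota> c * y)) 1"
      using c that by (subst V.sim_divide_iff) auto
    then show "\<exists>c u. c \<noteq> 0 \<and> u \<in> units_of_vr V \<and> x = \<iota> c * u * y"
      using c that by (intro exI[of _ c] exI[of _ "x / (\<iota> c * y)"]) (auto simp: V.units_iff V.sim_def)
  qed
  then have "{(x, y). x \<noteq> 0 \<and> y \<noteq> 0 \<and> (\<exists>c u. c \<noteq> 0 \<and> u \<in> units_of_vr V \<and> x = \<iota> c * u * y)} = class_rel"
    unfolding class_rel_def by blast
  then show ?thesis
    by (simp add: ram_index_def int_closure_eq)
qed

lemma equiv_class_rel: "equiv {x. x \<noteq> 0} class_rel"
proof (rule equivI)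
  show "class_rel \<subseteq> {x. x \<noteq> 0} \<times> {x. x \<noteq> 0}"
    by (auto simp: class_rel_def)
  show "refl_on {x. x \<noteq> 0} class_rel"
    by (auto simp: refl_on_def class_rel_def intro!: exI[of _ 1])
  show "sym class_rel"
  proof (rule symI)
    fix x y assume "(x, y) \<in> class_rel"
    then obtain c where c: "x \<noteq> 0" "y \<noteq> 0" "c \<noteq> 0" "V.sim x (\<iota> c * y)"
      by (auto simp: class_rel_def)
    then have "V.sim (\<iota> (inverse c) * (\<iota> c * y)) (\<iota> (inverse c) * x)"
      using V.sim_sym V.sim_refl V.sim_mult by blast
    moreover have "\<iota> (inverse c) * (\<iota> c * y) = y"
      using c by (simp add: emb_inverse)
    ultimately show "(y, x) \<in> class_rel"
      using c by (auto simp: class_rel_def intro!: exI[of _ "inverse c"])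
  qed
  show "trans class_rel"
  proof (rule transI)
    fix x y z assume "(x, y) \<in> class_rel" "(y, z) \<in> class_rel"
    then obtain c d where c: "x \<noteq> 0" "y \<noteq> 0" "z \<noteq> 0" "c \<noteq> 0" "d \<noteq> 0" "V.sim x (\<iota> c * y)" "V.sim y (\<iota> d * z)"
      by (auto simp: class_rel_def)
    then have "V.sim x (\<iota> c * (\<iota> d * z))"
      using V.sim_trans V.sim_refl V.sim_mult by blast
    then have "V.sim x (\<iota> (c * d) * z)"
      by (simp only: emb_mult mult.assoc)
    moreover have "c * d \<noteq> 0"
      using c by simp
    ultimately show "(x, z) \<in> class_rel"
      using c(1,3) unfolding class_rel_def by blast
  qed
qed

text \<open>The powers of \<open>z\<close> represent the classes: they are pairwise inequivalent,
  and an arbitrary element has the value of the largest term in its expansion.\<close>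

lemma ram_index_if_ramified:
  assumes z: "ramified_elem z"
  shows "ram_index \<iota> A = p"
  unfolding ram_index_eq
proof (rule card_quotient_family[OF equiv_class_rel, where z = "\<lambda>i. z ^ i"])
  have nz: "z \<noteq> 0"
    using z by (rule ramified_elem_nonzero)
  then show "z ^ i \<in> {x. x \<noteq> 0}" for i
    by simp
  show "(z ^ i, z ^ j) \<notin> class_rel" if "i < j" "j < p" for i j
    using ramified_elem_powers[OF z that, of 1] by (auto simp: class_rel_def)
  show "\<exists>i<p. (x, z ^ i) \<in> class_rel" if "x \<in> {x. x \<noteq> 0}" for x
  proof -
    have basis: "valuation_basis (\<lambda>i. z ^ i)"
      using z by (rule valuation_basis_ramified)
    obtain c where c: "x = (\<Sum>i<p. \<iota> (c i) * z ^ i)"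
      using valuation_basis_expand[OF basis] by blast
    obtain m where m: "m < p" "\<And>i. i < p \<Longrightarrow> V.le (\<iota> (c i) * z ^ i) (\<iota> (c m) * z ^ m)"
      using V.exists_max[of "{..<p}" "\<lambda>i. \<iota> (c i) * z ^ i"] K.p_pos by auto
    have "V.sim x (\<iota> (c m) * z ^ m)"
      using m valuation_basis_le[OF basis c m(1)] unfolding V.sim_def c by (auto intro: V.le_sum)
    then show ?thesis
      using that nz m(1) by (cases "c m = 0") (auto simp: class_rel_def)
  qed
qed

lemma ram_index_if_no_ramified:
  assumes "\<And>z. \<not> ramified_elem z"
  shows "ram_index \<iota> A = 1"
  unfolding ram_index_eq
proof (rule card_quotient_family[OF equiv_class_rel, where z = "\<lambda>i. 1"])
  fix x assume x: "x \<in> {x::'l. x \<noteq> 0}"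
  obtain c where c: "V.sim x (\<iota> c)"
    using assms[of x] unfolding ramified_elem_def by blast
  then have "(x, 1) \<in> class_rel"
    using x by (cases "c = 0") (auto simp: class_rel_def)
  then show "\<exists>i<1::nat. (x, 1) \<in> class_rel"
    by (intro exI[of _ 0]) simp
qed auto

lemma defectless_iff:
  "defectless \<iota> A \<longleftrightarrow> (\<exists>z. ramified_elem z) \<or> (\<exists>y. inertial_elem y)"
proof (cases "\<exists>z. ramified_elem z")
  case True
  then show ?thesis
    using ram_index_if_ramified residue_degree_if_no_inertial ramified_imp_not_inertial
    by (auto simp: defectless_def ext_degree_eq)
next
  case not_ramified: False
  then have e: "ram_index \<iota> A = 1"
    using ram_index_if_no_ramified by blast
  show ?thesis
  proof (cases "\<exists>y. inertial_elem y")
    case True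
    then obtain y where "y \<in> V" "res_independent y"
      using exists_res_independent by blast
    then show ?thesis
      using True e residue_degree_if_res_independent by (simp add: defectless_def ext_degree_eq)
  next
    case False
    then show ?thesis
      using not_ramified e residue_degree_if_no_inertial K.p_gt_1
      by (simp add: defectless_def ext_degree_eq)
  qed
qed

lemma exists_best_approx_if_defectless:
  assumes "(\<exists>z. ramified_elem z) \<or> (\<exists>y. inertial_elem y)"
  shows "\<exists>a. best_approx a"
  using assms exists_best_approx valuation_basis_ramified valuation_basis_res_independent
    exists_res_independent by metis

end

section \<open>Best generators\<close>

context AS_ext
begin

text \<open>\<open>\<sigma> \<beta> - \<beta>\<close> lies in the kernel of \<open>wp\<close>, so it
  is some \<open>i\<close> in the prime field; then \<open>\<beta> - i * \<alpha>\<close> is fixed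
  by \<sigma>.\<close>

lemma AS_root_form:
  assumes "wp p \<beta> = \<iota> g" "\<beta> \<notin> range \<iota>"
  shows "\<exists>i h. 0 < i \<and> i < p \<and> \<beta> = of_nat i * \<alpha> + \<iota> h"
proof -
  have "wp p (\<sigma> \<beta> - \<beta>) = \<sigma> (wp p \<beta>) - wp p \<beta>"
    unfolding L.wp_diff by (simp add: wp_def \<sigma>.emb_simps)
  then have "wp p (\<sigma> \<beta> - \<beta>) = 0"
    by (simp add: assms)
  then obtain i where i: "i < p" "\<sigma> \<beta> - \<beta> = of_nat i"
    unfolding L.wp_eq_0_iff by blast
  have "i \<noteq> 0"
  proof
    assume "i = 0"
    then have "\<sigma> \<beta> = \<beta>"
      using i by simp
    then show False
      using assms(2) by (simp add: \<sigma>_fixed_iff)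
  qed
  have "\<sigma> (\<beta> - of_nat i * \<alpha>) = \<beta> - of_nat i * \<alpha>"
    using i by (simp add: \<sigma>.emb_simps \<sigma>_gen algebra_simps)
  then obtain h where "\<beta> - of_nat i * \<alpha> = \<iota> h"
    unfolding \<sigma>_fixed_iff by blast
  then have "\<beta> = of_nat i * \<alpha> + \<iota> h"
    by (simp add: algebra_simps)
  then show ?thesis
    using i \<open>i \<noteq> 0\<close> by blast
qed

text \<open>Any root outside \<open>K\<close> generates, because
  \<open>\<beta> = i * \<alpha> + h\<close> with \<open>i\<close> invertible can be solved for
  \<alpha>. Later arguments can thus work with roots instead of generated fields.\<close>

lemma AS_generates_iff: "AS_generates p \<iota> g \<longleftrightarrow> (\<exists>\<beta>. wp p \<beta> = \<iota> g \<and> \<beta> \<notin> range \<iota>)"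
proof
  assume "AS_generates p \<iota> g"
  then show "\<exists>\<beta>. wp p \<beta> = \<iota> g \<and> \<beta> \<notin> range \<iota>"
    using gen_field_notin_range nontrivial unfolding AS_generates_def wp_def by blast
next
  assume "\<exists>\<beta>. wp p \<beta> = \<iota> g \<and> \<beta> \<notin> range \<iota>"
  then obtain \<beta> where \<beta>: "wp p \<beta> = \<iota> g" "\<beta> \<notin> range \<iota>"
    by blast
  then obtain i h where ih: "0 < i" "i < p" "\<beta> = of_nat i * \<alpha> + \<iota> h"
    using AS_root_form by blast
  have "of_nat i \<noteq> (0::'k)"
    using ih by (auto simp: K.of_nat_eq_0_iff dest: dvd_imp_le)
  then have "\<alpha> = \<iota> (inverse (of_nat i)) * (\<beta> + - \<iota> h)"
    using ih(3) emb_eq_zero_iff[of "of_nat i"] by (simp add: emb_inverse emb_of_nat)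
  then have \<alpha>: "\<alpha> \<in> gen_field \<iota> \<beta>"
    by (simp only:) (intro gen_field.intros)
  have "x \<in> gen_field \<iota> \<beta>" if "x \<in> gen_field \<iota> \<alpha>" for x
    using that by induction (use \<alpha> in \<open>auto intro: gen_field.intros\<close>)
  then show "AS_generates p \<iota> g"
    using \<beta>(1) gen unfolding AS_generates_def wp_def by blast
qed

end

context AS_val
begin

text \<open>Modulo the maximal ideal the polynomial is \<open>T ^ p - T\<close>, whose root 0 is
  simple with derivative -1.\<close>

lemma AS_root_in_range:
  assumes "A.lt g 1"
  shows "\<exists>b. wp p b = g"
proof -
  define P where "P = monom 1 p - monom 1 1 - [:g:]"
  have deg: "degree P = p"
    unfolding P_def using K.p_gt_1
    by (intro antisym degree_le le_degree) (auto simp: coeff_pCons split: nat.split)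
  have poly_P: "poly P x = wp p x - g" for x
    by (simp add: P_def poly_monom wp_def)
  have g: "g \<in> A"
    using assms A.lt_imp_le A.le_one_iff by blast
  have "\<exists>b. poly P b = 0"
  proof (rule henselian_lift)
    show "coeff P i \<in> A" for i
      using g by (auto simp: P_def coeff_pCons split: nat.split intro!: A.diff_mem A.uminus_mem)
    show "lead_coeff P = 1"
      unfolding deg using K.p_gt_1 by (simp add: P_def coeff_pCons split: nat.split)
    show "A.lt (poly P 0) 1"
      using assms K.p_pos by (simp add: poly_P wp_def power_0_left)
    have "pderiv P = monom (of_nat p) (p - 1) - [:1:]"
      by (simp add: P_def pderiv_diff pderiv_monom pderiv_pCons monom_0)
    then show "A.le 1 (poly (pderiv P) 0)"
      by (simp add: poly_monom)
  qed auto
  then show ?thesis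
    by (auto simp: poly_P)
qed

text \<open>A small \<open>g\<close> has a root in \<open>K\<close>, and all its roots differ by
  elements of the prime field.\<close>

lemma AS_gen_ge_one:
  assumes "wp p \<beta> = \<iota> g" "\<beta> \<notin> range \<iota>"
  shows "A.le 1 g"
proof (rule ccontr)
  assume "\<not> A.le 1 g"
  then obtain b where "wp p b = g"
    using AS_root_in_range by (auto simp: A.lt_def)
  then have "wp p (\<beta> - \<iota> b) = 0"
    using assms(1) emb_wp[of b] by (simp add: L.wp_diff)
  then obtain i where "\<beta> - \<iota> b = of_nat i"
    by (auto simp: L.wp_eq_0_iff)
  then have "\<beta> = \<iota> (b + of_nat i)"
    by (simp add: emb_simps algebra_simps)
  then show False
    using assms(2) by blast
qed

lemma wp_mem: "x \<in> V \<Longrightarrow> wp p x \<in> V"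
  by (auto simp: wp_def intro: V.diff_mem V.power_mem)

lemma sim_wp: "V.lt 1 x \<Longrightarrow> V.sim (wp p x) (x ^ p)"
proof -
  assume lt: "V.lt 1 x"
  then have "x \<noteq> 0"
    by auto
  have "V.lt (1 * x) (x ^ (p - 1) * x)"
    using \<open>x \<noteq> 0\<close> V.lt_power[OF lt, of "p - 1"] K.p_gt_1 by (subst V.lt_mult_right_iff) auto
  then have x: "V.lt x (x ^ p)"
    using K.p_pos by (simp flip: power_Suc2)
  then have "V.le (x ^ p) (- x + x ^ p)"
    by (intro V.le_add_lt) simp
  moreover have "V.le (x ^ p - x) (x ^ p)"
    using x V.lt_imp_le by (intro V.le_diff) auto
  ultimately show ?thesis
    by (simp add: V.sim_def wp_def)
qed

lemma lt_one_wp: "V.lt x 1 \<Longrightarrow> V.lt (wp p x) 1"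
  using V.lt_power[of x 1 p] K.p_pos by (auto simp: wp_def intro: V.lt_diff)

text \<open>A generator has \<open>v(g) \<le> 0\<close> by Hensel's lemma, hence \<open>v(g) = p * v(\<beta>)\<close> for every root \<open>\<beta>\<close>.\<close>

lemma sim_AS_root:
  assumes "wp p \<beta> = \<iota> g" "\<beta> \<notin> range \<iota>"
  shows "V.sim (\<iota> g) (\<beta> ^ p)"
proof (cases "V.lt 1 \<beta>")
  case True
  then show ?thesis
    using sim_wp assms by metis
next
  case False
  then have "V.le \<beta> 1"
    by (simp add: V.lt_def)
  then have "V.le (\<iota> g) 1"
    using wp_mem assms(1) by (metis V.le_one_iff)
  moreover have g: "V.le 1 (\<iota> g)"
    using AS_gen_ge_one[OF assms] by simp
  moreover have "V.le 1 \<beta>"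
    using lt_one_wp[of \<beta>] g assms(1) by (auto simp: V.lt_def)
  ultimately have "V.sim (\<iota> g) 1" "V.sim \<beta> 1"
    using \<open>V.le \<beta> 1\<close> by (simp_all add: V.sim_def)
  then show ?thesis
    using V.sim_power[of \<beta> 1 p] V.sim_sym V.sim_trans by (metis power_one)
qed

lemma AS_gen_le_iff:
  assumes "wp p \<beta> = \<iota> g" "\<beta> \<notin> range \<iota>" "wp p \<beta>' = \<iota> g'" "\<beta>' \<notin> range \<iota>"
  shows "A.le g g' \<longleftrightarrow> V.le \<beta> \<beta>'"
proof -
  have "V.le (\<iota> g) (\<iota> g') \<longleftrightarrow> V.le (\<beta> ^ p) (\<beta>' ^ p)"
    using sim_AS_root[OF assms(1,2)] sim_AS_root[OF assms(3,4)] V.le_trans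
    unfolding V.sim_def by blast
  then show ?thesis
    using K.p_pos by (simp add: V.le_power_iff)
qed

lemma gen_shift:
  "wp p (\<alpha> - \<iota> h) = \<iota> (f - wp p h)" "\<alpha> - \<iota> h \<notin> range \<iota>"
proof -
  show "wp p (\<alpha> - \<iota> h) = \<iota> (f - wp p h)"
    by (simp add: L.wp_diff root emb_diff emb_wp)
  show "\<alpha> - \<iota> h \<notin> range \<iota>"
  proof
    assume "\<alpha> - \<iota> h \<in> range \<iota>"
    then obtain c where "\<alpha> - \<iota> h = \<iota> c"
      by blast
    then have "\<alpha> = \<iota> (c + h)"
      by (simp add: emb_add algebra_simps)
    then show False
      using gen_notin_range by blast
  qed
qed

lemma best_gen_if_best_approx:
  assumes "best_approx a"
  shows "best_gen p \<iota> A (f - wp p a)"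
  unfolding best_gen_def
proof (intro conjI allI impI)
  show "AS_generates p \<iota> (f - wp p a)"
    using gen_shift AS_generates_iff by blast
next
  fix g assume "AS_generates p \<iota> g"
  then obtain \<beta> where \<beta>: "wp p \<beta> = \<iota> g" "\<beta> \<notin> range \<iota>"
    by (auto simp: AS_generates_iff)
  then obtain i h where ih: "0 < i" "i < p" "\<beta> = of_nat i * \<alpha> + \<iota> h"
    using AS_root_form by blast
  have i: "A.le 1 (of_nat i)"
    using ih one_le_of_nat by blast
  then have "of_nat i \<noteq> (0::'k)"
    by auto
  \<comment> \<open>Factoring the unit \<open>i\<close> out of \<beta> leaves the approximation
    error of \<alpha> at \<open>- h / i\<close>.\<close>
  have "V.le (1 * (\<alpha> - \<iota> a)) (\<iota> (of_nat i) * (\<alpha> - \<iota> (- h / of_nat i)))"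
    using i assms unfolding best_approx_def by (intro V.le_mult) auto
  also have "\<iota> (of_nat i) * (\<alpha> - \<iota> (- h / of_nat i)) = \<beta>"
    using \<open>of_nat i \<noteq> (0::'k)\<close> ih(3) emb_eq_zero_iff[of "of_nat i"]
    by (simp add: emb_divide emb_uminus emb_of_nat algebra_simps)
  finally have "A.le (f - wp p a) g"
    using AS_gen_le_iff[OF gen_shift \<beta>] by simp
  then show "val_ge A (f - wp p a) g"
    by (simp add: A.le_def)
qed

section \<open>The three conditions on a generator\<close>

definition cond_i :: "'k \<Rightarrow> bool" where
  "cond_i g \<longleftrightarrow> g \<notin> A \<and> \<not> (\<exists>h. h \<noteq> 0 \<and> g / h ^ p \<in> units_of_vr A)"

definition cond_ii :: "'k \<Rightarrow> bool" where
  "cond_ii g \<longleftrightarrow> g \<notin> A \<and> (\<exists>h u. h \<noteq> 0 \<and> h \<in> max_ideal A \<and> u \<in> units_of_vr A \<and>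
     g = u * inverse (h ^ p) \<and> \<not> (\<exists>x\<in>A. u - x ^ p \<in> max_ideal A))"

definition cond_iii :: "'k \<Rightarrow> bool" where
  "cond_iii g \<longleftrightarrow> g \<in> units_of_vr A \<and> \<not> (\<exists>x\<in>A. g - (x ^ p - x) \<in> max_ideal A)"

text \<open>(ii) exhibits the value of \<open>g\<close> as a multiple of \<open>p\<close>, and (iii)
  places \<open>g\<close> in \<open>A\<close>. Hence "exactly one" amounts to "at least
  one".\<close>

lemma conds_exclusive: "cond_ii g \<Longrightarrow> \<not> cond_i g" "cond_iii g \<Longrightarrow> \<not> cond_i g \<and> \<not> cond_ii g"
proof -
  show "\<not> cond_i g" if ii: "cond_ii g"
  proof -
    obtain h u where h: "h \<noteq> 0" "u \<in> units_of_vr A" "g = u * inverse (h ^ p)"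
      using ii by (auto simp: cond_ii_def)
    then have "g / inverse h ^ p \<in> units_of_vr A"
      by (simp add: power_inverse)
    then show ?thesis
      using h(1) unfolding cond_i_def by (metis nonzero_imp_inverse_nonzero)
  qed
qed (auto simp: cond_i_def cond_ii_def cond_iii_def units_of_vr_def)

lemma AS_generates_shift:
  assumes "AS_generates p \<iota> g"
  shows "AS_generates p \<iota> (g - wp p h)"
proof -
  obtain \<beta> where \<beta>: "wp p \<beta> = \<iota> g" "\<beta> \<notin> range \<iota>"
    using assms by (auto simp: AS_generates_iff)
  have "wp p (\<beta> - \<iota> h) = \<iota> (g - wp p h)"
    by (simp add: L.wp_diff \<beta> emb_diff emb_wp)
  moreover have "\<beta> - \<iota> h \<notin> range \<iota>"
    using \<beta>(2) by (metis (no_types, lifting) diff_add_cancel emb_add image_iff rangeI)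
  ultimately show ?thesis
    unfolding AS_generates_iff by blast
qed

lemma best_gen_imp_cond:
  assumes best: "best_gen p \<iota> A g"
  shows "cond_i g \<or> cond_ii g \<or> cond_iii g"
proof (cases "g \<in> A")
  case True
  have "A.le 1 g"
    using best AS_gen_ge_one by (auto simp: best_gen_def AS_generates_iff)
  then have unit: "g \<in> units_of_vr A"
    using True by (simp add: A.units_iff A.le_one_iff)
  \<comment> \<open>A small difference would be a generator of positive value, which Hensel's lemma
    excludes.\<close>
  have "\<not> A.lt (g - wp p x) 1" for x
    using best AS_generates_shift AS_gen_ge_one
    by (metis A.lt_def AS_generates_iff best_gen_def)
  then have "cond_iii g"
    using unit by (simp add: cond_iii_def A.max_ideal_iff wp_def)
  then show ?thesis by blast
next
  case False
  show ?thesis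
  proof (rule ccontr)
    assume none: "\<not> ?thesis"
    then obtain h where h: "h \<noteq> 0" "g / h ^ p \<in> units_of_vr A"
      using False by (auto simp: cond_i_def)
    define u where "u = g / h ^ p"
    have g: "g = u * h ^ p"
      using h by (simp add: u_def)
    have u: "A.le u 1" "A.le 1 u"
      using h by (auto simp: u_def A.units_iff)
    have "A.lt 1 g"
      using False by (simp add: A.lt_def A.le_one_iff)
    also have "A.le g (1 * h ^ p)"
      unfolding g using u by (intro A.le_mult) auto
    finally have "A.lt (1 ^ p) (h ^ p)"
      by simp
    then have h1: "A.lt 1 h"
      using K.p_pos by (simp add: A.lt_power_iff del: power_one)
    then have "h \<notin> A"
      by (simp add: A.lt_def A.le_one_iff)
    then have "inverse h \<in> max_ideal A"
      by (simp add: A.max_ideal_iff A.lt_one_iff)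
    moreover have "g = u * inverse (inverse h ^ p)"
      by (simp add: g power_inverse)
    ultimately obtain x where x: "x \<in> A" "A.lt (u - x ^ p) 1"
      using none False h unfolding cond_ii_def A.max_ideal_iff u_def
      by (metis nonzero_imp_inverse_nonzero)
    \<comment> \<open>The correction \<open>x * h\<close> comes from \<open>u\<close> being
      congruent to \<open>x ^ p\<close>: its \<open>p\<close>-th power cancels the leading part of
      \<open>g = u * h ^ p\<close>, and its linear term is negligible because \<open>h\<close> lies
      outside \<open>A\<close> and \<open>p > 1\<close>.\<close>
    have "A.lt (g - wp p (x * h)) (h ^ p)"
    proof -
      have "A.lt ((u - x ^ p) * h ^ p) (1 * h ^ p)"
        using x(2) h(1) by (subst A.lt_mult_right_iff) auto
      moreover have "A.lt (x * h) (h ^ p)"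
      proof -
        have "A.le (x * h) (1 * h)"
          using x(1) by (intro A.le_mult) (auto simp: A.le_one_iff)
        also have "A.lt (1 * h) (h ^ (p - 1) * h)"
          using h(1) A.lt_power[OF h1, of "p - 1"] K.p_gt_1 by (subst A.lt_mult_right_iff) auto
        also have "h ^ (p - 1) * h = h ^ p"
          using K.p_pos by (simp flip: power_Suc2)
        finally show ?thesis .
      qed
      moreover have "g - wp p (x * h) = (u - x ^ p) * h ^ p + x * h"
        by (simp add: g wp_def power_mult_distrib algebra_simps)
      ultimately show ?thesis
        by (simp add: A.lt_add)
    qed
    also have "A.le (h ^ p) g"
      unfolding g using A.le_mult[of 1 u "h ^ p" "h ^ p"] u by simp
    finally have "A.lt (g - wp p (x * h)) g"
      by simp
    moreover have "A.le g (g - wp p (x * h))"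
      using best AS_generates_shift unfolding best_gen_def A.le_def by blast
    ultimately show False
      by (simp add: A.lt_def)
  qed
qed

lemma cond_imp_defectless:
  assumes "AS_generates p \<iota> g" "cond_i g \<or> cond_ii g \<or> cond_iii g"
  shows "(\<exists>z. ramified_elem z) \<or> (\<exists>y. inertial_elem y)"
proof -
  obtain \<beta> where \<beta>: "wp p \<beta> = \<iota> g" "\<beta> \<notin> range \<iota>"
    using assms(1) by (auto simp: AS_generates_iff)
  have sim: "V.sim (\<iota> g) (\<beta> ^ p)"
    using sim_AS_root[OF \<beta>] .
  consider "cond_i g" | "cond_ii g" | "cond_iii g"
    using assms(2) by blast
  then show ?thesis
  proof cases
    case 1
    have "ramified_elem \<beta>"
      unfolding ramified_elem_def
    proof (intro allI notI)
      fix h assume h: "V.sim \<beta> (\<iota> h)"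
      have "\<beta> \<noteq> 0"
        using \<beta>(2) emb_zero by (metis rangeI)
      then have "h \<noteq> 0"
        using h by auto
      have "V.sim (\<iota> g) (\<iota> (h ^ p))"
        using sim V.sim_power[OF h, of p] V.sim_trans by (simp add: emb_power)
      then have "A.sim (g / h ^ p) 1"
        using \<open>h \<noteq> 0\<close> by (simp add: A.sim_divide_iff)
      then show False
        using 1 \<open>h \<noteq> 0\<close> by (auto simp: cond_i_def A.units_iff A.sim_def)
    qed
    then show ?thesis by blast
  next
    case 2
    then obtain h u where h: "h \<noteq> 0" "A.lt h 1" "A.sim u 1" "g = u * inverse (h ^ p)"
      and u: "\<And>x. x \<in> A \<Longrightarrow> \<not> A.lt (u - x ^ p) 1"
      by (auto simp: cond_ii_def A.max_ideal_iff A.units_iff A.sim_def)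
    define y where "y = \<beta> * \<iota> h"
    have "V.sim (y ^ p) (\<iota> g * \<iota> (h ^ p))"
      unfolding y_def power_mult_distrib emb_power
      using sim by (intro V.sim_mult V.sim_sym[OF sim]) auto
    also have "\<iota> g * \<iota> (h ^ p) = \<iota> u"
      using h by (simp flip: emb_mult)
    also have "V.sim (\<iota> u) (\<iota> 1)"
      using h(3) by (simp only: emb_sim_iff)
    finally have "V.le (y ^ p) (1 ^ p)"
      by (simp add: V.sim_def)
    then have y: "y \<in> V"
      using K.p_pos by (simp add: V.le_power_iff V.le_one_iff del: power_one)
    \<comment> \<open>Multiplying \<open>\<beta> ^ p - \<beta> = g\<close> by \<open>h ^ p\<close>
      turns the linear term into \<open>h ^ (p - 1) * y\<close>, which is small; so \<open>y\<close>
      is a \<open>p\<close>-th root of \<open>u\<close> modulo the maximal ideal.\<close>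
    have eq: "y ^ p - \<iota> u = \<iota> h ^ (p - 1) * y"
    proof -
      have "\<iota> h ^ p = \<iota> h ^ (p - 1) * \<iota> h"
        using K.p_pos by (simp flip: power_Suc2)
      have "\<iota> u = \<iota> g * \<iota> h ^ p"
        using h by (simp flip: emb_mult emb_power)
      also have "\<dots> = (\<beta> ^ p - \<beta>) * \<iota> h ^ p"
        using \<beta>(1) by (simp add: wp_def)
      also have "\<dots> = y ^ p - \<beta> * (\<iota> h ^ (p - 1) * \<iota> h)"
        by (simp add: y_def power_mult_distrib left_diff_distrib \<open>\<iota> h ^ p = _\<close>)
      finally show ?thesis
        by (simp add: y_def)
    qed
    have "V.lt (\<iota> h ^ (p - 1)) (1 ^ (p - 1))"
      using h(2) K.p_gt_1 by (intro V.lt_power) auto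
    then have lt: "V.lt (\<iota> h ^ (p - 1) * y) 1"
      using y by (intro V.lt_one_mult) auto
    \<comment> \<open>If \<open>y\<close> were congruent to \<open>a\<close>, Frobenius would make
      \<open>u\<close> congruent to \<open>a ^ p\<close>.\<close>
    have "V.le 1 (y - \<iota> a)" if a: "a \<in> A" for a
    proof (rule ccontr)
      assume "\<not> V.le 1 (y - \<iota> a)"
      then have "V.lt ((y - \<iota> a) ^ p) (1 ^ p)"
        using K.p_pos by (intro V.lt_power) (auto simp: V.lt_def)
      then have "V.lt ((y ^ p - \<iota> (a ^ p)) - (y ^ p - \<iota> u)) 1"
        using lt unfolding eq by (intro V.lt_diff[of "y ^ p - \<iota> (a ^ p)"]) (auto simp: L.frobenius_diff emb_power)
      then have "V.lt (\<iota> (u - a ^ p)) 1"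
        by (simp add: emb_diff)
      then show False
        using u[OF a] by simp
    qed
    then show ?thesis
      using y unfolding inertial_elem_def by blast
  next
    case 3
    then have g: "A.le g 1" and no_root: "\<And>x. x \<in> A \<Longrightarrow> \<not> A.lt (g - wp p x) 1"
      by (auto simp: cond_iii_def A.max_ideal_iff A.units_iff wp_def)
    have "V.le (\<beta> ^ p) (\<iota> g)"
      using sim by (simp add: V.sim_def)
    also have "V.le (\<iota> g) (1 ^ p)"
      using g by simp
    finally have "\<beta> \<in> V"
      using K.p_pos by (simp add: V.le_power_iff V.le_one_iff del: power_one)
    moreover have "V.le 1 (\<beta> - \<iota> a)" if a: "a \<in> A" for a
    proof (rule ccontr)
      assume "\<not> V.le 1 (\<beta> - \<iota> a)"
      then have "V.lt (wp p (\<beta> - \<iota> a)) 1"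
        by (intro lt_one_wp) (simp add: V.lt_def)
      then have "V.lt (\<iota> (g - wp p a)) 1"
        by (simp add: L.wp_diff \<beta> emb_diff emb_wp)
      then show False
        using no_root[OF a] by simp
    qed
    ultimately show ?thesis
      unfolding inertial_elem_def by blast
  qed
qed

lemma best_gen_iff_cond:
  "(\<exists>g. best_gen p \<iota> A g) \<longleftrightarrow> (\<exists>g. AS_generates p \<iota> g \<and> (cond_i g \<or> cond_ii g \<or> cond_iii g))"
  "(\<exists>g. best_gen p \<iota> A g) \<longleftrightarrow> defectless \<iota> A"
proof -
  have "\<exists>g. AS_generates p \<iota> g \<and> (cond_i g \<or> cond_ii g \<or> cond_iii g)" if "best_gen p \<iota> A g" for g
    using best_gen_imp_cond[OF that] that unfolding best_gen_def by blast
  moreover have "defectless \<iota> A" if "AS_generates p \<iota> g" "cond_i g \<or> cond_ii g \<or> cond_iii g" for g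
    using cond_imp_defectless[OF that] unfolding defectless_iff .
  moreover have "\<exists>g. best_gen p \<iota> A g" if "defectless \<iota> A"
    using that exists_best_approx_if_defectless best_gen_if_best_approx unfolding defectless_iff by blast
  ultimately show
    "(\<exists>g. best_gen p \<iota> A g) \<longleftrightarrow> (\<exists>g. AS_generates p \<iota> g \<and> (cond_i g \<or> cond_ii g \<or> cond_iii g))"
    "(\<exists>g. best_gen p \<iota> A g) \<longleftrightarrow> defectless \<iota> A"
    by blast+
qed

end

theorem theorem3p2p3:
  fixes p :: nat and A :: "'k::field set" and \<iota> :: "'k \<Rightarrow> 'l::field"
  assumes "prime p"
    and "valuation_ring A"
    and "henselian A"
    and "\<exists>x\<in>A. x \<noteq> 0 \<and> inverse x \<notin> A"
    and "CHAR('k) = p"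
    and "field_emb \<iota>"
    and "nontrivial_AS_ext p \<iota>"
  shows "((\<exists>f. best_gen p \<iota> A f) \<longleftrightarrow>
      (\<exists>f. AS_generates p \<iota> f \<and>
        (let P1 = (f \<notin> A \<and> \<not> (\<exists>h. h \<noteq> 0 \<and> f / h ^ p \<in> units_of_vr A));
             P2 = (f \<notin> A \<and> (\<exists>g u. g \<noteq> 0 \<and> g \<in> max_ideal A \<and> u \<in> units_of_vr A \<and>
                      f = u * inverse (g ^ p) \<and>
                      \<not> (\<exists>x\<in>A. u - x ^ p \<in> max_ideal A)));
             P3 = (f \<in> units_of_vr A \<and> \<not> (\<exists>x\<in>A. f - (x ^ p - x) \<in> max_ideal A))
         in (P1 \<and> \<not> P2 \<and> \<not> P3) \<or> (\<not> P1 \<and> P2 \<and> \<not> P3) \<or> (\<not> P1 \<and> \<not> P2 \<and> P3))))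
    \<and> ((\<exists>f. best_gen p \<iota> A f) \<longleftrightarrow> defectless \<iota> A)"
proof -
  interpret field_embedding \<iota>
    by unfold_locales fact
  obtain V where V: "valuation_ring V" "\<iota> -` V = A"
    using exists_valuation_ring_extension assms(2) by blast
  obtain f0 \<alpha> where "wp p \<alpha> = \<iota> f0" "gen_field \<iota> \<alpha> = UNIV" "range \<iota> \<noteq> UNIV"
    using assms(7) unfolding nontrivial_AS_ext_def AS_generates_def wp_def by blast
  then interpret AS_val \<iota> p \<alpha> f0 A V
    using assms V by unfold_locales auto
  have "(cond_i f \<or> cond_ii f \<or> cond_iii f) \<longleftrightarrow>
      (let P1 = cond_i f; P2 = cond_ii f; P3 = cond_iii f
       in (P1 \<and> \<not> P2 \<and> \<not> P3) \<or> (\<not> P1 \<and> P2 \<and> \<not> P3) \<or> (\<not> P1 \<and> \<not> P2 \<and> P3))" for f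
    using conds_exclusive[of f] unfolding Let_def by blast
  then show ?thesis
    using best_gen_iff_cond unfolding cond_i_def cond_ii_def cond_iii_def by simp
qed

end
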